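(* Let $x=x_1,\dots,x_n$ be an $n$-tuple of elements in an $A$-algebra $R$, and let $\mathcal A\subseteq\mathcal R$ be the ring extension with $\mathcal A=\mathrm{TS}^n_AR[\alpha^2(x)^{-1}]$ and $\mathcal R=\mathrm{TS}^{n-1,1}_AR[\alpha^2(x)^{-1}]$. Then the elements $\varphi_n(x_1),\dots,\varphi_n(x_n)$ in the $R$-algebra $\mathcal R$ form an $\mathcal A$-module basis of $\mathcal R$.
   Context: All rings are commutative with unit; $n\ge1$. $\mathrm T^n_AR=R\otimes_A\cdots\otimes_AR$ ($n$ factors), and $\varphi_p:R\to\mathrm T^n_AR$ is the co-projection on the $p$-th factor. The symmetric group $\mathfrak S_n$ permutes the factors; $\mathrm{TS}^n_AR=(\mathrm T^n_AR)^{\mathfrak S_n}$, and $\mathrm{TS}^{n-1,1}_AR=(\mathrm T^n_AR)^{\mathfrak S_{n-1}}$, where $\mathfrak S_{n-1}$ permutes the first $n-1$ factors. The alternating tensor is $\alpha(x)=\sum_{\sigma\in\mathfrak S_n}(-1)^{|\sigma|}x_{\sigma(1)}\otimes\cdots\otimes x_{\sigma(n)}\in\mathrm T^n_AR$; its square $\alpha^2(x)$ lies in $\mathrm{TS}^n_AR$. The brackets $[\alpha^2(x)^{-1}]$ denote localization at the element $\alpha^2(x)$. The $R$-algebra structure $\varphi_n:R\to\mathcal R$ is induced by the co-projection on the last factor (whose image lies in $\mathrm{TS}^{n-1,1}_AR$). *)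

theory Defs
  imports
    "HOL-Algebra.Free_Abelian_Groups"
    "HOL-Algebra.QuotRing"
    "HOL-Algebra.Module"
    "HOL-Algebra.Subrings"
    "HOL-Combinatorics.Permutations"
begin

section \<open>Tensor powers of an algebra\<close>

text \<open>
  The underlying additive group is the free abelian group on \<open>R\<^sup>n\<close>; the product of two basis
  elements is their componentwise product, so this is the integral monoid ring of the
  multiplicative monoid \<open>R\<^sup>n\<close>.
\<close>

definition tuple_ring :: "('r, 'm) ring_scheme \<Rightarrow> nat \<Rightarrow> ((nat \<Rightarrow> 'r) \<Rightarrow>\<^sub>0 int) ring" where
  "tuple_ring R n =
    \<lparr>carrier = carrier (free_Abelian_group ({1..n} \<rightarrow>\<^sub>E carrier R)),
     monoid.mult = (\<lambda>f g. frag_extend (\<lambda>u. frag_extend (\<lambda>v. frag_of (\<lambda>p\<in>{1..n}. u p \<otimes>\<^bsub>R\<^esub> v p)) g) f),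
     one = frag_of (\<lambda>p\<in>{1..n}. \<one>\<^bsub>R\<^esub>),
     zero = 0,
     add = (+)\<rparr>"

definition tensor_relations ::
    "('a, 'c) ring_scheme \<Rightarrow> ('a, 'r, 'm) module_scheme \<Rightarrow> nat \<Rightarrow> ((nat \<Rightarrow> 'r) \<Rightarrow>\<^sub>0 int) set" where
  "tensor_relations A R n =
    {frag_of (u(p := a \<oplus>\<^bsub>R\<^esub> b)) - frag_of (u(p := a)) - frag_of (u(p := b)) | u p a b.
       u \<in> {1..n} \<rightarrow>\<^sub>E carrier R \<and> p \<in> {1..n} \<and> a \<in> carrier R \<and> b \<in> carrier R} \<union>
    {frag_of (u(p := c \<odot>\<^bsub>R\<^esub> u p)) - frag_of (u(q := c \<odot>\<^bsub>R\<^esub> u q)) | u p q c.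
       u \<in> {1..n} \<rightarrow>\<^sub>E carrier R \<and> p \<in> {1..n} \<and> q \<in> {1..n} \<and> c \<in> carrier A}"

text \<open>
  Multiplying a relation by a basis element gives another relation, so the ideal generated by
  the relations is just the additive subgroup generated by them, and the quotient is the usual
  \<open>n\<close>-fold tensor product of \<open>R\<close> over \<open>A\<close>.
\<close>

definition tensor_ideal ::
    "('a, 'c) ring_scheme \<Rightarrow> ('a, 'r, 'm) module_scheme \<Rightarrow> nat \<Rightarrow> ((nat \<Rightarrow> 'r) \<Rightarrow>\<^sub>0 int) set" where
  "tensor_ideal A R n = Idl\<^bsub>tuple_ring R n\<^esub> (tensor_relations A R n)"

definition tensor_power ::
    "('a, 'c) ring_scheme \<Rightarrow> ('a, 'r, 'm) module_scheme \<Rightarrow> nat \<Rightarrow> ((nat \<Rightarrow> 'r) \<Rightarrow>\<^sub>0 int) set ring" where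
  "tensor_power A R n = tuple_ring R n Quot tensor_ideal A R n"

definition pure_tensor ::
    "('a, 'c) ring_scheme \<Rightarrow> ('a, 'r, 'm) module_scheme \<Rightarrow> nat \<Rightarrow> (nat \<Rightarrow> 'r) \<Rightarrow>
      ((nat \<Rightarrow> 'r) \<Rightarrow>\<^sub>0 int) set" where
  "pure_tensor A R n u = tensor_ideal A R n +>\<^bsub>tuple_ring R n\<^esub> frag_of (restrict u {1..n})"

definition coprojection ::
    "('a, 'c) ring_scheme \<Rightarrow> ('a, 'r, 'm) module_scheme \<Rightarrow> nat \<Rightarrow> nat \<Rightarrow> 'r \<Rightarrow>
      ((nat \<Rightarrow> 'r) \<Rightarrow>\<^sub>0 int) set" where
  "coprojection A R n p r = pure_tensor A R n (\<lambda>i. if i = p then r else \<one>\<^bsub>R\<^esub>)"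

text \<open>
  \<open>permute_frag \<sigma>\<close> is the additive extension of \<open>u \<mapsto> u \<circ> \<sigma>\<close>. For \<open>\<sigma>\<close> permuting \<open>{1..n}\<close> it
  preserves the tensor ideal, so it maps the class of \<open>f\<close>, as a set, onto the class of
  \<open>permute_frag \<sigma> f\<close>; see \<open>permute_coset\<close> below.
\<close>

definition permute_frag :: "(nat \<Rightarrow> nat) \<Rightarrow> ((nat \<Rightarrow> 'r) \<Rightarrow>\<^sub>0 int) \<Rightarrow> ((nat \<Rightarrow> 'r) \<Rightarrow>\<^sub>0 int)" where
  "permute_frag \<sigma> = frag_extend (\<lambda>u. frag_of (u \<circ> \<sigma>))"

definition permute_factors ::
    "(nat \<Rightarrow> nat) \<Rightarrow> ((nat \<Rightarrow> 'r) \<Rightarrow>\<^sub>0 int) set \<Rightarrow> ((nat \<Rightarrow> 'r) \<Rightarrow>\<^sub>0 int) set" where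
  "permute_factors \<sigma> X = permute_frag \<sigma> ` X"

definition tensor_invariants ::
    "('a, 'c) ring_scheme \<Rightarrow> ('a, 'r, 'm) module_scheme \<Rightarrow> nat \<Rightarrow> nat set \<Rightarrow>
      ((nat \<Rightarrow> 'r) \<Rightarrow>\<^sub>0 int) set ring" where
  "tensor_invariants A R n S = (tensor_power A R n)
    \<lparr>carrier := {X \<in> carrier (tensor_power A R n). \<forall>\<sigma>. \<sigma> permutes S \<longrightarrow> permute_factors \<sigma> X = X}\<rparr>"

definition TS ::
    "('a, 'c) ring_scheme \<Rightarrow> ('a, 'r, 'm) module_scheme \<Rightarrow> nat \<Rightarrow> ((nat \<Rightarrow> 'r) \<Rightarrow>\<^sub>0 int) set ring" where
  "TS A R n = tensor_invariants A R n {1..n}"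

definition TS_last ::
    "('a, 'c) ring_scheme \<Rightarrow> ('a, 'r, 'm) module_scheme \<Rightarrow> nat \<Rightarrow> ((nat \<Rightarrow> 'r) \<Rightarrow>\<^sub>0 int) set ring" where
  "TS_last A R n = tensor_invariants A R n {1..n - 1}"

definition alternating_tensor ::
    "('a, 'c) ring_scheme \<Rightarrow> ('a, 'r, 'm) module_scheme \<Rightarrow> nat \<Rightarrow> (nat \<Rightarrow> 'r) \<Rightarrow>
      ((nat \<Rightarrow> 'r) \<Rightarrow>\<^sub>0 int) set" where
  "alternating_tensor A R n x =
    (\<Oplus>\<^bsub>tensor_power A R n\<^esub>\<sigma>\<in>{\<sigma>. \<sigma> permutes {1..n}}.
       [sign \<sigma>] \<cdot>\<^bsub>tensor_power A R n\<^esub> pure_tensor A R n (x \<circ> \<sigma>))"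

definition alternating_square ::
    "('a, 'c) ring_scheme \<Rightarrow> ('a, 'r, 'm) module_scheme \<Rightarrow> nat \<Rightarrow> (nat \<Rightarrow> 'r) \<Rightarrow>
      ((nat \<Rightarrow> 'r) \<Rightarrow>\<^sub>0 int) set" where
  "alternating_square A R n x =
    alternating_tensor A R n x \<otimes>\<^bsub>tensor_power A R n\<^esub> alternating_tensor A R n x"


section \<open>Localization at an element\<close>

text \<open>The pair \<open>(r, k)\<close> stands for the fraction \<open>r / s\<^sup>k\<close>; a fraction is an equivalence class.\<close>

definition fraction :: "('a, 'm) ring_scheme \<Rightarrow> 'a \<Rightarrow> 'a \<Rightarrow> nat \<Rightarrow> ('a \<times> nat) set" where
  "fraction R s r k = {(r', l). r' \<in> carrier R \<and>
     (\<exists>m::nat. s [^]\<^bsub>R\<^esub> m \<otimes>\<^bsub>R\<^esub> (s [^]\<^bsub>R\<^esub> l \<otimes>\<^bsub>R\<^esub> r) = s [^]\<^bsub>R\<^esub> m \<otimes>\<^bsub>R\<^esub> (s [^]\<^bsub>R\<^esub> k \<otimes>\<^bsub>R\<^esub> r'))}"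

definition localization :: "('a, 'm) ring_scheme \<Rightarrow> 'a \<Rightarrow> ('a \<times> nat) set ring" where
  "localization R s =
    \<lparr>carrier = {fraction R s r k | r k. r \<in> carrier R},
     monoid.mult = (\<lambda>X Y. \<Union>(r, k)\<in>X. \<Union>(r', l)\<in>Y. fraction R s (r \<otimes>\<^bsub>R\<^esub> r') (k + l)),
     one = fraction R s \<one>\<^bsub>R\<^esub> 0,
     zero = fraction R s \<zero>\<^bsub>R\<^esub> 0,
     add = (\<lambda>X Y. \<Union>(r, k)\<in>X. \<Union>(r', l)\<in>Y.
       fraction R s (s [^]\<^bsub>R\<^esub> l \<otimes>\<^bsub>R\<^esub> r \<oplus>\<^bsub>R\<^esub> s [^]\<^bsub>R\<^esub> k \<otimes>\<^bsub>R\<^esub> r') (k + l))\<rparr>"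

text \<open>
  The canonical map \<open>B\<^sub>s \<rightarrow> C\<^sub>s\<close> for a subring \<open>B\<close> of \<open>C\<close>, sending \<open>r / s\<^sup>k\<close> to \<open>r / s\<^sup>k\<close>.
\<close>

definition localization_map :: "('a, 'm) ring_scheme \<Rightarrow> 'a \<Rightarrow> ('a \<times> nat) set \<Rightarrow> ('a \<times> nat) set" where
  "localization_map C s X = (\<Union>(r, k)\<in>X. fraction C s r k)"


section \<open>Modules and bases\<close>

definition module_via_hom :: "('a \<Rightarrow> 'b) \<Rightarrow> ('b, 'm) ring_scheme \<Rightarrow> ('a, 'b) module" where
  "module_via_hom h C =
    \<lparr>carrier = carrier C, monoid.mult = monoid.mult C, one = one C, zero = zero C, add = add C,
     smult = (\<lambda>a y. h a \<otimes>\<^bsub>C\<^esub> y)\<rparr>"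

definition module_basis ::
    "('a, 'c) ring_scheme \<Rightarrow> ('a, 'b, 'm) module_scheme \<Rightarrow> 'i set \<Rightarrow> ('i \<Rightarrow> 'b) \<Rightarrow> bool" where
  "module_basis K M I b \<longleftrightarrow>
     module K M \<and> b \<in> I \<rightarrow> carrier M \<and>
     (\<forall>c \<in> I \<rightarrow> carrier K. (\<Oplus>\<^bsub>M\<^esub>i\<in>I. c i \<odot>\<^bsub>M\<^esub> b i) = \<zero>\<^bsub>M\<^esub> \<longrightarrow> (\<forall>i\<in>I. c i = \<zero>\<^bsub>K\<^esub>)) \<and>
     (\<forall>y \<in> carrier M. \<exists>c \<in> I \<rightarrow> carrier K. y = (\<Oplus>\<^bsub>M\<^esub>i\<in>I. c i \<odot>\<^bsub>M\<^esub> b i))"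

section \<open>Well-definedness\<close>

subsection \<open>Tensor powers\<close>

lemma frag_extend_fun_diff: "frag_extend (\<lambda>u. f u - g u) c = frag_extend f c - frag_extend g c"
  by (rule frag_induction[of c UNIV]) (auto simp: frag_extend_diff)

lemma frag_extend_fun_0: "frag_extend (\<lambda>u. 0) c = 0"
  by (simp add: frag_extend_eq_0)

lemma frag_extend_fun_add: "frag_extend (\<lambda>u. f u + g u) c = frag_extend f c + frag_extend g c"
  by (rule frag_induction[of c UNIV]) (auto simp: frag_extend_diff)

lemma tuple_ring_simps:
  "carrier (tuple_ring R n) = {c. Poly_Mapping.keys c \<subseteq> {1..n} \<rightarrow>\<^sub>E carrier R}"
  "f \<otimes>\<^bsub>tuple_ring R n\<^esub> g =
     frag_extend (\<lambda>u. frag_extend (\<lambda>v. frag_of (\<lambda>p\<in>{1..n}. u p \<otimes>\<^bsub>R\<^esub> v p)) g) f"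
  "\<one>\<^bsub>tuple_ring R n\<^esub> = frag_of (\<lambda>p\<in>{1..n}. \<one>\<^bsub>R\<^esub>)"
  "\<zero>\<^bsub>tuple_ring R n\<^esub> = 0"
  "f \<oplus>\<^bsub>tuple_ring R n\<^esub> g = f + g"
  by (simp_all add: tuple_ring_def set_eq_iff)

lemma tuple_mult_of:
  "frag_of u \<otimes>\<^bsub>tuple_ring R n\<^esub> frag_of v = frag_of (\<lambda>p\<in>{1..n}. u p \<otimes>\<^bsub>R\<^esub> v p)"
  by (simp add: tuple_ring_simps)

lemma tuple_mult_linear:
  "(f - f') \<otimes>\<^bsub>tuple_ring R n\<^esub> g = f \<otimes>\<^bsub>tuple_ring R n\<^esub> g - f' \<otimes>\<^bsub>tuple_ring R n\<^esub> g"
  "(f + f') \<otimes>\<^bsub>tuple_ring R n\<^esub> g = f \<otimes>\<^bsub>tuple_ring R n\<^esub> g + f' \<otimes>\<^bsub>tuple_ring R n\<^esub> g"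
  "f \<otimes>\<^bsub>tuple_ring R n\<^esub> (g - g') = f \<otimes>\<^bsub>tuple_ring R n\<^esub> g - f \<otimes>\<^bsub>tuple_ring R n\<^esub> g'"
  "f \<otimes>\<^bsub>tuple_ring R n\<^esub> (g + g') = f \<otimes>\<^bsub>tuple_ring R n\<^esub> g + f \<otimes>\<^bsub>tuple_ring R n\<^esub> g'"
  "0 \<otimes>\<^bsub>tuple_ring R n\<^esub> g = 0"
  "f \<otimes>\<^bsub>tuple_ring R n\<^esub> 0 = 0"
  by (simp_all add: tuple_ring_simps frag_extend_diff frag_extend_add frag_extend_fun_diff
     frag_extend_fun_add frag_extend_fun_0)

lemma (in cring) tuple_ring_cring: "cring (tuple_ring R n)"
proof -
  let ?P = "tuple_ring R n"
  let ?S = "{1..n} \<rightarrow>\<^sub>E carrier R"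
  have mem: "(\<lambda>p\<in>{1..n}. u p \<otimes> v p) \<in> ?S" if "u \<in> ?S" "v \<in> ?S" for u v
    using that by (auto simp: PiE_iff)
  have closed: "f \<otimes>\<^bsub>?P\<^esub> g \<in> carrier ?P" if "f \<in> carrier ?P" "g \<in> carrier ?P" for f g
  proof -
    have f: "Poly_Mapping.keys f \<subseteq> ?S" and g: "Poly_Mapping.keys g \<subseteq> ?S"
      using that by (auto simp: tuple_ring_simps)
    show ?thesis unfolding tuple_ring_simps mem_Collect_eq
      apply (rule order_trans[OF keys_frag_extend])
      apply (rule UN_least)
      apply (rule order_trans[OF keys_frag_extend])
      apply (rule UN_least)
      using f g mem by auto
  qed
  have comm: "f \<otimes>\<^bsub>?P\<^esub> g = g \<otimes>\<^bsub>?P\<^esub> f" if "f \<in> carrier ?P" "g \<in> carrier ?P" for f g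
  proof -
    have f: "Poly_Mapping.keys f \<subseteq> ?S" and g: "Poly_Mapping.keys g \<subseteq> ?S"
      using that by (auto simp: tuple_ring_simps)
    show ?thesis using f
    proof (induction f rule: frag_induction)
      case (one u)
      show ?case using g
      proof (induction g rule: frag_induction)
        case (one v)
        show ?case unfolding tuple_mult_of
          using \<open>u \<in> ?S\<close> one by (intro arg_cong[of _ _ frag_of] restrict_ext m_comm) (auto simp: PiE_iff)
      qed (auto simp: tuple_mult_linear)
    qed (auto simp: tuple_mult_linear)
  qed
  have assoc: "f \<otimes>\<^bsub>?P\<^esub> g \<otimes>\<^bsub>?P\<^esub> h = f \<otimes>\<^bsub>?P\<^esub> (g \<otimes>\<^bsub>?P\<^esub> h)"
    if "f \<in> carrier ?P" "g \<in> carrier ?P" "h \<in> carrier ?P" for f g h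
  proof -
    have f: "Poly_Mapping.keys f \<subseteq> ?S" and g: "Poly_Mapping.keys g \<subseteq> ?S" and h: "Poly_Mapping.keys h \<subseteq> ?S"
      using that by (auto simp: tuple_ring_simps)
    show ?thesis using f
    proof (induction f rule: frag_induction)
      case (one u)
      show ?case using g
      proof (induction g rule: frag_induction)
        case (one v)
        show ?case using h
        proof (induction h rule: frag_induction)
          case (one w)
          show ?case unfolding tuple_mult_of
            using \<open>u \<in> ?S\<close> \<open>v \<in> ?S\<close> one
            by (intro arg_cong[of _ _ frag_of] restrict_ext) (auto simp: PiE_iff m_assoc)
        qed (auto simp: tuple_mult_linear)
      qed (auto simp: tuple_mult_linear)
    qed (auto simp: tuple_mult_linear)
  qed
  have onel: "\<one>\<^bsub>?P\<^esub> \<otimes>\<^bsub>?P\<^esub> f = f" if "f \<in> carrier ?P" for f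
  proof -
    have f: "Poly_Mapping.keys f \<subseteq> ?S"
      using that by (auto simp: tuple_ring_simps)
    show ?thesis using f
    proof (induction f rule: frag_induction)
      case (one u)
      have "(\<lambda>p\<in>{1..n}. (\<lambda>p\<in>{1..n}. \<one>) p \<otimes> u p) = u"
        using one by (auto simp: fun_eq_iff PiE_iff extensional_def)
      then show ?case by (simp only: tuple_ring_simps(3) tuple_mult_of)
    qed (auto simp: tuple_mult_linear)
  qed
  have ab: "abelian_group ?P"
  proof (rule abelian_groupI)
    fix f assume "f \<in> carrier ?P"
    then show "\<exists>y\<in>carrier ?P. y \<oplus>\<^bsub>?P\<^esub> f = \<zero>\<^bsub>?P\<^esub>"
      by (intro bexI[of _ "-f"]) (auto simp: tuple_ring_simps)
  qed (use keys_add in \<open>fastforce simp: tuple_ring_simps\<close>)+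
  show ?thesis
  proof (rule cringI[OF ab])
    show "comm_monoid ?P"
      by (rule comm_monoidI) (use closed comm assoc onel in \<open>auto simp: tuple_ring_simps(1,3) PiE_iff\<close>)
  qed (simp add: tuple_ring_simps(5) tuple_mult_linear)
qed

lemma fun_upd_in_PiE: "u \<in> I \<rightarrow>\<^sub>E B \<Longrightarrow> p \<in> I \<Longrightarrow> a \<in> B \<Longrightarrow> u(p := a) \<in> I \<rightarrow>\<^sub>E B"
  by (auto simp: PiE_iff extensional_def)

lemma permute_frag_simps: "permute_frag \<sigma> (f - g) = permute_frag \<sigma> f - permute_frag \<sigma> g" "permute_frag \<sigma> (f + g) = permute_frag \<sigma> f + permute_frag \<sigma> g"
   "permute_frag \<sigma> 0 = 0" "permute_frag \<sigma> (frag_of u) = frag_of (u \<circ> \<sigma>)"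
  by (simp_all add: permute_frag_def frag_extend_diff frag_extend_add)

lemma permute_frag_comp: "permute_frag \<sigma> (permute_frag \<tau> f) = permute_frag (\<tau> \<circ> \<sigma>) f"
  by (rule frag_induction[of f UNIV]) (auto simp: permute_frag_simps comp_def)

lemma permute_frag_id: "permute_frag id f = f"
  by (rule frag_induction[of f UNIV]) (auto simp: permute_frag_simps comp_def)

lemma comp_permutes_PiE: assumes "\<sigma> permutes I" "u \<in> I \<rightarrow>\<^sub>E B" shows "u \<circ> \<sigma> \<in> I \<rightarrow>\<^sub>E B"
  using assms by (auto simp: PiE_iff extensional_def permutes_in_image)

lemma fun_upd_comp_perm: assumes "\<sigma> permutes I" shows "u(p := a) \<circ> \<sigma> = (u \<circ> \<sigma>)(inv_into UNIV \<sigma> p := a)"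
  using permutes_inverses[OF assms] by (auto simp: fun_eq_iff)

context algebra begin

lemma tensor_relations_subset: "tensor_relations R M n \<subseteq> carrier (tuple_ring M n)"
proof
  fix z assume z: "z \<in> tensor_relations R M n"
  interpret P: cring "tuple_ring M n" by (rule tuple_ring_cring)
  have minus: "a - b \<in> carrier (tuple_ring M n)" if "a \<in> carrier (tuple_ring M n)" "b \<in> carrier (tuple_ring M n)" for a b
    using that keys_diff[of a b] by (auto simp: tuple_ring_simps)
  have of: "frag_of u \<in> carrier (tuple_ring M n)" if "u \<in> {1..n} \<rightarrow>\<^sub>E carrier M" for u
    using that by (auto simp: tuple_ring_simps)
  show "z \<in> carrier (tuple_ring M n)"
    using z unfolding tensor_relations_def
    by (safe; intro minus of fun_upd_in_PiE smult_closed) (auto simp: PiE_iff)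
qed

lemma tensor_ideal_ideal: "ideal (tensor_ideal R M n) (tuple_ring M n)"
proof -
  interpret P: cring "tuple_ring M n" by (rule tuple_ring_cring)
  show ?thesis unfolding tensor_ideal_def by (rule P.genideal_ideal[OF tensor_relations_subset])
qed

lemma tensor_power_cring: "cring (tensor_power R M n)"
  unfolding tensor_power_def
  by (rule ideal.quotient_is_cring[OF tensor_ideal_ideal tuple_ring_cring])


lemma permute_frag_closed:
  assumes "\<sigma> permutes {1..n}" "f \<in> carrier (tuple_ring M n)"
  shows "permute_frag \<sigma> f \<in> carrier (tuple_ring M n)"
  unfolding permute_frag_def tuple_ring_simps mem_Collect_eq
proof (rule order_trans[OF keys_frag_extend], rule UN_least)
  fix u assume "u \<in> Poly_Mapping.keys f"
  then have "u \<in> {1..n} \<rightarrow>\<^sub>E carrier M" using assms(2) unfolding tuple_ring_simps by blast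
  then show "Poly_Mapping.keys (frag_of (u \<circ> \<sigma>)) \<subseteq> {1..n} \<rightarrow>\<^sub>E carrier M"
    using comp_permutes_PiE[OF assms(1), of u "carrier M"] by (simp only: keys_frag_of) blast
qed

lemma permute_frag_mult:
  assumes "\<sigma> permutes {1..n}"
  shows "permute_frag \<sigma> (f \<otimes>\<^bsub>tuple_ring M n\<^esub> g) = permute_frag \<sigma> f \<otimes>\<^bsub>tuple_ring M n\<^esub> permute_frag \<sigma> g"
proof -
  have "Poly_Mapping.keys f \<subseteq> UNIV" by simp
  then show ?thesis
  proof (induction f rule: frag_induction)
    case (one u)
    have "Poly_Mapping.keys g \<subseteq> UNIV" by simp
    then show ?case
    proof (induction g rule: frag_induction)
      case (one v)
      show ?case unfolding permute_frag_simps tuple_mult_of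
        apply (rule arg_cong[of _ _ frag_of])
        using permutes_in_image[OF assms] permutes_not_in[OF assms] by (auto simp: fun_eq_iff restrict_def)
    qed (auto simp: tuple_mult_linear permute_frag_simps)
  qed (auto simp: tuple_mult_linear permute_frag_simps)
qed

lemma permute_frag_one: assumes "\<sigma> permutes {1..n}" shows "permute_frag \<sigma> \<one>\<^bsub>tuple_ring M n\<^esub> = \<one>\<^bsub>tuple_ring M n\<^esub>"
  unfolding permute_frag_simps tuple_ring_simps
  using permutes_in_image[OF assms] permutes_not_in[OF assms]
  by (intro arg_cong[of _ _ frag_of]) (auto simp: fun_eq_iff restrict_def)

lemma permute_frag_relations:
  assumes "\<sigma> permutes {1..n}" "z \<in> tensor_relations R M n"
  shows "permute_frag \<sigma> z \<in> tensor_relations R M n"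
proof -
  note 1 = comp_permutes_PiE[OF assms(1), of _ "carrier M"]
  have 2: "inv_into UNIV \<sigma> p \<in> {1..n}" if "p \<in> {1..n}" for p
    using permutes_in_image[OF permutes_inv[OF assms(1)]] that by blast
  have 3: "\<sigma> (inv_into UNIV \<sigma> p) = p" for p using permutes_inverses[OF assms(1)] by simp
  from assms(2) consider
    (add) u p a b where "z = frag_of (u(p := a \<oplus>\<^bsub>M\<^esub> b)) - frag_of (u(p := a)) - frag_of (u(p := b))"
       "u \<in> {1..n} \<rightarrow>\<^sub>E carrier M" "p \<in> {1..n}" "a \<in> carrier M" "b \<in> carrier M"
   | (bal) u p q c where "z = frag_of (u(p := c \<odot>\<^bsub>M\<^esub> u p)) - frag_of (u(q := c \<odot>\<^bsub>M\<^esub> u q))"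
       "u \<in> {1..n} \<rightarrow>\<^sub>E carrier M" "p \<in> {1..n}" "q \<in> {1..n}" "c \<in> carrier R"
    unfolding tensor_relations_def by blast
  then show ?thesis
  proof cases
    case add
    have "permute_frag \<sigma> z = frag_of ((u\<circ>\<sigma>)(inv_into UNIV \<sigma> p := a \<oplus>\<^bsub>M\<^esub> b)) - frag_of ((u\<circ>\<sigma>)(inv_into UNIV \<sigma> p := a)) - frag_of ((u\<circ>\<sigma>)(inv_into UNIV \<sigma> p := b))"
      unfolding add permute_frag_simps fun_upd_comp_perm[OF assms(1)] by simp
    then show ?thesis unfolding tensor_relations_def using add 1 2 by blast
  next
    case bal
    have "permute_frag \<sigma> z = frag_of ((u\<circ>\<sigma>)(inv_into UNIV \<sigma> p := c \<odot>\<^bsub>M\<^esub> (u\<circ>\<sigma>) (inv_into UNIV \<sigma> p))) - frag_of ((u\<circ>\<sigma>)(inv_into UNIV \<sigma> q := c \<odot>\<^bsub>M\<^esub> (u\<circ>\<sigma>) (inv_into UNIV \<sigma> q)))"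
      unfolding bal permute_frag_simps fun_upd_comp_perm[OF assms(1)] by (simp add: 3)
    then show ?thesis unfolding tensor_relations_def using bal 1 2 by blast
  qed
qed

lemma permute_frag_ideal_sub:
  assumes "\<sigma> permutes {1..n}" "z \<in> tensor_ideal R M n"
  shows "permute_frag \<sigma> z \<in> tensor_ideal R M n"
proof -
  interpret P: cring "tuple_ring M n" by (rule tuple_ring_cring)
  interpret I: ideal "tensor_ideal R M n" "tuple_ring M n" by (rule tensor_ideal_ideal)
  interpret h: ring_hom_ring "tuple_ring M n" "tuple_ring M n" "permute_frag \<sigma>"
    by unfold_locales (use assms(1) in \<open>auto intro!: ring_hom_memI permute_frag_closed permute_frag_mult permute_frag_one simp: tuple_ring_simps(5) permute_frag_simps\<close>)
  have "ideal {r \<in> carrier (tuple_ring M n). permute_frag \<sigma> r \<in> tensor_ideal R M n} (tuple_ring M n)"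
    by (rule h.ideal_vimage) (rule tensor_ideal_ideal)
  moreover have "tensor_relations R M n \<subseteq> {r \<in> carrier (tuple_ring M n). permute_frag \<sigma> r \<in> tensor_ideal R M n}"
    using tensor_relations_subset permute_frag_relations[OF assms(1)] P.genideal_self[OF tensor_relations_subset]
    unfolding tensor_ideal_def by blast
  ultimately show ?thesis using assms(2) P.genideal_minimal unfolding tensor_ideal_def by blast
qed

lemma permute_frag_ideal:
  assumes s: "\<sigma> permutes {1..n}"
  shows "permute_frag \<sigma> ` tensor_ideal R M n = tensor_ideal R M n"
proof
  show "tensor_ideal R M n \<subseteq> permute_frag \<sigma> ` tensor_ideal R M n"
  proof
    fix z assume "z \<in> tensor_ideal R M n"
    then have "permute_frag (inv_into UNIV \<sigma>) z \<in> tensor_ideal R M n" by (intro permute_frag_ideal_sub permutes_inv s)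
    moreover have "z = permute_frag \<sigma> (permute_frag (inv_into UNIV \<sigma>) z)"
      by (simp add: permute_frag_comp permutes_inv_o[OF s] permute_frag_id)
    ultimately show "z \<in> permute_frag \<sigma> ` tensor_ideal R M n" by blast
  qed
qed (use permute_frag_ideal_sub[OF s] in blast)

lemma tensor_coset_eq: "tensor_ideal R M n +>\<^bsub>tuple_ring M n\<^esub> f = (\<lambda>i. i + f) ` tensor_ideal R M n"
  by (auto simp: a_r_coset_def' tuple_ring_simps)

lemma permute_coset:
  assumes s: "\<sigma> permutes {1..n}"
  shows "permute_factors \<sigma> (tensor_ideal R M n +>\<^bsub>tuple_ring M n\<^esub> f) = tensor_ideal R M n +>\<^bsub>tuple_ring M n\<^esub> permute_frag \<sigma> f"
proof -
  have "permute_factors \<sigma> (tensor_ideal R M n +>\<^bsub>tuple_ring M n\<^esub> f) = (\<lambda>i. i + permute_frag \<sigma> f) ` permute_frag \<sigma> ` tensor_ideal R M n"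
    unfolding tensor_coset_eq permute_factors_def image_image permute_frag_simps ..
  then show ?thesis using permute_frag_ideal[OF s] tensor_coset_eq by simp
qed

lemma carrier_tensor_power: "carrier (tensor_power R M n) = {tensor_ideal R M n +>\<^bsub>tuple_ring M n\<^esub> f | f. f \<in> carrier (tuple_ring M n)}"
  unfolding tensor_power_def FactRing_def A_RCOSETS_def' by auto

lemma tensor_coset_hom: "(+>\<^bsub>tuple_ring M n\<^esub>) (tensor_ideal R M n) \<in> ring_hom (tuple_ring M n) (tensor_power R M n)"
  unfolding tensor_power_def by (rule ideal.rcos_ring_hom[OF tensor_ideal_ideal])

lemma permute_factors_hom:
  assumes s: "\<sigma> permutes {1..n}"
  shows "permute_factors \<sigma> \<in> ring_hom (tensor_power R M n) (tensor_power R M n)"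
proof -
  interpret P: cring "tuple_ring M n" by (rule tuple_ring_cring)
  note h = tensor_coset_hom[of n]
  show ?thesis
  proof (rule ring_hom_memI)
    fix X assume "X \<in> carrier (tensor_power R M n)"
    then obtain f where f: "f \<in> carrier (tuple_ring M n)" "X = tensor_ideal R M n +>\<^bsub>tuple_ring M n\<^esub> f"
      unfolding carrier_tensor_power by blast
    show "permute_factors \<sigma> X \<in> carrier (tensor_power R M n)"
      unfolding f permute_coset[OF s] by (rule ring_hom_closed[OF h permute_frag_closed[OF s f(1)]])
    fix Y assume "Y \<in> carrier (tensor_power R M n)"
    then obtain g where g: "g \<in> carrier (tuple_ring M n)" "Y = tensor_ideal R M n +>\<^bsub>tuple_ring M n\<^esub> g"
      unfolding carrier_tensor_power by blast
    show "permute_factors \<sigma> (X \<otimes>\<^bsub>tensor_power R M n\<^esub> Y) = permute_factors \<sigma> X \<otimes>\<^bsub>tensor_power R M n\<^esub> permute_factors \<sigma> Y"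
      unfolding f g ring_hom_mult[OF h f(1) g(1), symmetric] permute_coset[OF s] permute_frag_mult[OF s]
      using permute_frag_closed[OF s] f g by (simp add: ring_hom_mult[OF h])
    show "permute_factors \<sigma> (X \<oplus>\<^bsub>tensor_power R M n\<^esub> Y) = permute_factors \<sigma> X \<oplus>\<^bsub>tensor_power R M n\<^esub> permute_factors \<sigma> Y"
      unfolding f g ring_hom_add[OF h f(1) g(1), symmetric] permute_coset[OF s] tuple_ring_simps(5) permute_frag_simps
      using ring_hom_add[OF h permute_frag_closed[OF s f(1)] permute_frag_closed[OF s g(1)]] by (simp add: tuple_ring_simps(5))
  next
    show "permute_factors \<sigma> \<one>\<^bsub>tensor_power R M n\<^esub> = \<one>\<^bsub>tensor_power R M n\<^esub>"
      unfolding ring_hom_one[OF h, symmetric] permute_coset[OF s] permute_frag_one[OF s] ..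
  qed
qed

lemma tensor_invariants_subcring:
  assumes "S \<subseteq> {1..n}"
  shows "subcring (carrier (tensor_invariants R M n S)) (tensor_power R M n)"
proof -
  interpret T: cring "tensor_power R M n" by (rule tensor_power_cring)
  have p: "\<sigma> permutes {1..n}" if "\<sigma> permutes S" for \<sigma> using that assms permutes_subset by blast
  have inv: "permute_factors \<sigma> (\<ominus>\<^bsub>tensor_power R M n\<^esub> X) = \<ominus>\<^bsub>tensor_power R M n\<^esub> permute_factors \<sigma> X"
    if "\<sigma> permutes S" "X \<in> carrier (tensor_power R M n)" for \<sigma> X
  proof -
    interpret h: ring_hom_cring "tensor_power R M n" "tensor_power R M n" "permute_factors \<sigma>"
      using permute_factors_hom[OF p[OF that(1)]] by unfold_locales
    show ?thesis using that by simp
  qed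
  show ?thesis
    apply (rule T.subcringI', rule T.subringI)
    using p inv by (auto simp: tensor_invariants_def ring_hom_mult[OF permute_factors_hom] ring_hom_add[OF permute_factors_hom] ring_hom_one[OF permute_factors_hom])
qed

lemma pure_tensor_closed: "x \<in> {1..n} \<rightarrow> carrier M \<Longrightarrow> pure_tensor R M n x \<in> carrier (tensor_power R M n)"
  unfolding pure_tensor_def by (rule ring_hom_closed[OF tensor_coset_hom]) (auto simp: tuple_ring_simps)

lemma permute_factors_pure_tensor:
  assumes s: "\<sigma> permutes {1..n}"
  shows "permute_factors \<sigma> (pure_tensor R M n x) = pure_tensor R M n (x \<circ> \<sigma>)"
proof -
  have "restrict x {1..n} \<circ> \<sigma> = restrict (x \<circ> \<sigma>) {1..n}"
    using permutes_in_image[OF s] permutes_not_in[OF s] by (auto simp: fun_eq_iff restrict_def)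
  then show ?thesis unfolding pure_tensor_def permute_coset[OF s] permute_frag_simps by simp
qed

lemma coprojection_mem:
  assumes "n \<ge> 1" "r \<in> carrier M"
  shows "coprojection R M n n r \<in> carrier (TS_last R M n)"
proof -
  have "permute_factors \<sigma> (coprojection R M n n r) = coprojection R M n n r" if s: "\<sigma> permutes {1..n-1}" for \<sigma>
  proof -
    have s': "\<sigma> permutes {1..n}" by (rule permutes_subset[OF s]) auto
    have "\<sigma> n = n" using s assms by (auto simp: permutes_def)
    then have "\<sigma> i = n \<longleftrightarrow> i = n" for i using permutes_inj[OF s] by (metis injD)
    then show ?thesis unfolding coprojection_def permute_factors_pure_tensor[OF s'] by (simp add: comp_def)
  qed
  moreover have "coprojection R M n n r \<in> carrier (tensor_power R M n)"
    unfolding coprojection_def using assms by (intro pure_tensor_closed) auto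
  ultimately show ?thesis by (simp add: TS_last_def tensor_invariants_def)
qed

lemma alternating_square_mem:
  assumes x: "x \<in> {1..n} \<rightarrow> carrier M"
  shows "alternating_square R M n x \<in> carrier (TS R M n)"
proof -
  let ?T = "tensor_power R M n"
  interpret T: cring ?T by (rule tensor_power_cring)
  let ?A = "alternating_tensor R M n x"
  have pc: "pure_tensor R M n (x \<circ> \<tau>) \<in> carrier ?T" if "\<tau> permutes {1..n}" for \<tau>
    using x permutes_in_image[OF that] by (intro pure_tensor_closed) (auto simp: Pi_iff)
  have Ac: "?A \<in> carrier ?T"
    unfolding alternating_tensor_def using pc by (intro T.finsum_closed) (auto intro: T.add.int_pow_closed)
  have "permute_factors \<sigma> ?A = [sign \<sigma>] \<cdot>\<^bsub>?T\<^esub> ?A" if s: "\<sigma> permutes {1..n}" for \<sigma>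
  proof -
    interpret h: ring_hom_cring ?T ?T "permute_factors \<sigma>"
      using permute_factors_hom[OF s] by unfold_locales
    have hp: "permute_factors \<sigma> ([sign \<tau>] \<cdot>\<^bsub>?T\<^esub> X) = [sign \<tau>] \<cdot>\<^bsub>?T\<^esub> permute_factors \<sigma> X" if "X \<in> carrier ?T" for X \<tau>
      using that by (cases \<tau> rule: sign_cases) (auto simp: T.add.int_pow_neg)
    have sc: "[sign \<tau>] \<cdot>\<^bsub>?T\<^esub> X = [sign \<sigma>] \<cdot>\<^bsub>?T\<^esub> ([sign (\<tau> \<circ> \<sigma>)] \<cdot>\<^bsub>?T\<^esub> X)" if "X \<in> carrier ?T" "\<tau> permutes {1..n}" for X \<tau>
    proof -
      have "sign (\<tau> \<circ> \<sigma>) = sign \<tau> * sign \<sigma>"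
        using s that(2) by (intro sign_compose) (auto simp: permutation_permutes)
      then show ?thesis using that
        by (cases \<tau> rule: sign_cases; cases \<sigma> rule: sign_cases) (auto simp: T.add.int_pow_neg)
    qed
    have "permute_factors \<sigma> ?A = (\<Oplus>\<^bsub>?T\<^esub>\<tau>\<in>{\<tau>. \<tau> permutes {1..n}}. permute_factors \<sigma> ([sign \<tau>] \<cdot>\<^bsub>?T\<^esub> pure_tensor R M n (x \<circ> \<tau>)))"
      unfolding alternating_tensor_def
      apply (subst h.hom_finsum) using pc by (auto simp: comp_def)
    also have "\<dots> = (\<Oplus>\<^bsub>?T\<^esub>\<tau>\<in>{\<tau>. \<tau> permutes {1..n}}. [sign \<sigma>] \<cdot>\<^bsub>?T\<^esub> ([sign (\<tau> \<circ> \<sigma>)] \<cdot>\<^bsub>?T\<^esub> pure_tensor R M n (x \<circ> (\<tau> \<circ> \<sigma>))))"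
      apply (rule T.finsum_cong')
      using pc permutes_compose[OF s] by (auto simp: hp permute_factors_pure_tensor[OF s] comp_assoc sc[symmetric])
    also have "\<dots> = (\<Oplus>\<^bsub>?T\<^esub>\<tau>\<in>(\<lambda>\<tau>. \<tau> \<circ> \<sigma>) ` {\<tau>. \<tau> permutes {1..n}}. [sign \<sigma>] \<cdot>\<^bsub>?T\<^esub> ([sign \<tau>] \<cdot>\<^bsub>?T\<^esub> pure_tensor R M n (x \<circ> \<tau>)))"
      apply (rule T.finsum_reindex[symmetric])
       apply (rule funcsetI, rule T.add.int_pow_closed, rule T.add.int_pow_closed, rule pc)
      using permutes_compose[OF s] apply blast
      apply (rule inj_onI)
      by (metis (no_types) permutes_inv_o(1)[OF s] comp_assoc comp_id)
    also have "(\<lambda>\<tau>. \<tau> \<circ> \<sigma>) ` {\<tau>. \<tau> permutes {1..n}} = {\<tau>. \<tau> permutes {1..n}}"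
      by (rule image_compose_permutations_right[OF s, unfolded setcompr_eq_image])
    also have "(\<Oplus>\<^bsub>?T\<^esub>\<tau>\<in>{\<tau>. \<tau> permutes {1..n}}. [sign \<sigma>] \<cdot>\<^bsub>?T\<^esub> ([sign \<tau>] \<cdot>\<^bsub>?T\<^esub> pure_tensor R M n (x \<circ> \<tau>))) = [sign \<sigma>] \<cdot>\<^bsub>?T\<^esub> ?A"
    proof (cases \<sigma> rule: sign_cases)
      case even
      have "(\<Oplus>\<^bsub>?T\<^esub>\<tau>\<in>{\<tau>. \<tau> permutes {1..n}}. [sign \<sigma>] \<cdot>\<^bsub>?T\<^esub> ([sign \<tau>] \<cdot>\<^bsub>?T\<^esub> pure_tensor R M n (x \<circ> \<tau>))) = ?A"
        unfolding alternating_tensor_def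
        by (rule T.finsum_cong') (use pc even in auto)
      then show ?thesis using even Ac by simp
    next
      case odd
      have "(\<Oplus>\<^bsub>?T\<^esub>\<tau>\<in>{\<tau>. \<tau> permutes {1..n}}. \<ominus>\<^bsub>?T\<^esub> ([sign \<tau>] \<cdot>\<^bsub>?T\<^esub> pure_tensor R M n (x \<circ> \<tau>))) = \<ominus>\<^bsub>?T\<^esub> ?A"
        (is "?B = _")
      proof -
        have Bc: "?B \<in> carrier ?T" using pc by (intro T.finsum_closed) auto
        have "?B \<oplus>\<^bsub>?T\<^esub> ?A = (\<Oplus>\<^bsub>?T\<^esub>\<tau>\<in>{\<tau>. \<tau> permutes {1..n}}. \<ominus>\<^bsub>?T\<^esub> ([sign \<tau>] \<cdot>\<^bsub>?T\<^esub> pure_tensor R M n (x \<circ> \<tau>)) \<oplus>\<^bsub>?T\<^esub> ([sign \<tau>] \<cdot>\<^bsub>?T\<^esub> pure_tensor R M n (x \<circ> \<tau>)))"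
          unfolding alternating_tensor_def
          by (rule T.finsum_addf[symmetric]) (use pc in auto)
        also have "\<dots> = (\<Oplus>\<^bsub>?T\<^esub>\<tau>\<in>{\<tau>. \<tau> permutes {1..n}}. \<zero>\<^bsub>?T\<^esub>)"
          by (rule T.finsum_cong') (use pc in \<open>auto simp: T.l_neg\<close>)
        also have "\<dots> = \<zero>\<^bsub>?T\<^esub>" by simp
        finally show ?thesis using T.minus_equality[OF _ Ac Bc] by simp
      qed
      moreover have "(\<Oplus>\<^bsub>?T\<^esub>\<tau>\<in>{\<tau>. \<tau> permutes {1..n}}. [sign \<sigma>] \<cdot>\<^bsub>?T\<^esub> ([sign \<tau>] \<cdot>\<^bsub>?T\<^esub> pure_tensor R M n (x \<circ> \<tau>))) = ?B"
        by (rule T.finsum_cong') (use pc odd in \<open>auto simp: T.add.int_pow_neg\<close>)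
      ultimately show ?thesis using odd Ac by (simp add: T.add.int_pow_neg)
    qed
    finally show ?thesis .
  qed
  then have "permute_factors \<sigma> (?A \<otimes>\<^bsub>?T\<^esub> ?A) = ?A \<otimes>\<^bsub>?T\<^esub> ?A" if s: "\<sigma> permutes {1..n}" for \<sigma>
    unfolding ring_hom_mult[OF permute_factors_hom[OF s] Ac Ac] using Ac s
    by (cases \<sigma> rule: sign_cases) (auto simp: T.add.int_pow_neg T.l_minus T.r_minus)
  then show ?thesis using Ac by (simp add: TS_def tensor_invariants_def alternating_square_def)
qed

end

subsection \<open>Localization\<close>

context cring begin
lemma nat_pow_add: "s \<in> carrier R \<Longrightarrow> s [^] (a + b :: nat) = s [^] a \<otimes> s [^] b"
  by (simp add: nat_pow_mult)

lemma fraction_eq_iff: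
  assumes s: "s \<in> carrier R" and r: "r \<in> carrier R" "r' \<in> carrier R"
  shows "fraction R s r k = fraction R s r' l \<longleftrightarrow>
    (\<exists>m::nat. s [^] m \<otimes> (s [^] l \<otimes> r) = s [^] m \<otimes> (s [^] k \<otimes> r'))" (is "_ \<longleftrightarrow> ?E r k r' l")
proof -
  have refl: "?E r k r k" for r k by auto
  have sym: "?E r' l r k" if "?E r k r' l" for r k r' l using that by metis
  have trans: "?E r k r'' j" if E: "?E r k r' l" "?E r' l r'' j" and c: "r \<in> carrier R" "r' \<in> carrier R" "r'' \<in> carrier R" for r k r' l r'' j
  proof -
    obtain m m' :: nat where m: "s [^] m \<otimes> (s [^] l \<otimes> r) = s [^] m \<otimes> (s [^] k \<otimes> r')" and m': "s [^] m' \<otimes> (s [^] j \<otimes> r') = s [^] m' \<otimes> (s [^] l \<otimes> r'')"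
      using E by blast
    have "s [^] (m + m' + l) \<otimes> (s [^] j \<otimes> r) = (s [^] m' \<otimes> s [^] j) \<otimes> (s [^] m \<otimes> (s [^] l \<otimes> r))"
      using s c by (simp add: nat_pow_add m_ac)
    also have "\<dots> = (s [^] m \<otimes> s [^] k) \<otimes> (s [^] m' \<otimes> (s [^] j \<otimes> r'))" unfolding m using s c by (simp add: m_ac)
    also have "\<dots> = s [^] (m + m' + l) \<otimes> (s [^] k \<otimes> r'')" unfolding m' using s c by (simp add: nat_pow_add m_ac)
    finally show ?thesis by blast
  qed
  show ?thesis
  proof
    assume "fraction R s r k = fraction R s r' l"
    moreover have "(r', l) \<in> fraction R s r' l" using r by (auto simp: fraction_def)
    ultimately have "(r', l) \<in> fraction R s r k" by blast
    then show "?E r k r' l" by (auto simp: fraction_def)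
  next
    assume E: "?E r k r' l"
    have "(\<exists>m::nat. s [^] m \<otimes> (s [^] j \<otimes> r) = s [^] m \<otimes> (s [^] k \<otimes> z)) = (\<exists>m::nat. s [^] m \<otimes> (s [^] j \<otimes> r') = s [^] m \<otimes> (s [^] l \<otimes> z))" if z: "z \<in> carrier R" for z and j::nat
      using trans[OF E _ r z] trans[OF sym[OF E] _ r(2) r(1) z] by blast
    then show "fraction R s r k = fraction R s r' l" unfolding fraction_def by blast
  qed
qed

lemma fraction_memI: "r \<in> carrier R \<Longrightarrow> (r, k) \<in> fraction R s r k" by (auto simp: fraction_def)

lemma fraction_memD:
  assumes "s \<in> carrier R" "r \<in> carrier R" "(r', l) \<in> fraction R s r k" shows "r' \<in> carrier R" "fraction R s r' l = fraction R s r k"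
proof -
  show "r' \<in> carrier R" using assms by (auto simp: fraction_def)
  then show "fraction R s r' l = fraction R s r k" using assms(3) by (subst eq_commute, subst fraction_eq_iff[OF assms(1,2)]) (auto simp: fraction_def)
qed

lemma UN_fraction:
  assumes "s \<in> carrier R" "r \<in> carrier R"
   and "\<And>r' l. r' \<in> carrier R \<Longrightarrow> fraction R s r' l = fraction R s r k \<Longrightarrow> F r' l = F r k"
  shows "(\<Union>(r', l)\<in>fraction R s r k. F r' l) = F r k"
proof -
  have "F r' l = F r k" if "(r', l) \<in> fraction R s r k" for r' l
    using assms(3) fraction_memD[OF assms(1,2) that] by blast
  then show ?thesis using fraction_memI[OF assms(2)] by fast
qed

lemma fraction_mult:
  assumes s: "s \<in> carrier R" and r: "r \<in> carrier R" "r' \<in> carrier R"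
  shows "fraction R s r k \<otimes>\<^bsub>localization R s\<^esub> fraction R s r' l = fraction R s (r \<otimes> r') (k + l)"
proof -
  have A: "fraction R s (q \<otimes> q') (j + i) = fraction R s (p \<otimes> q') (j' + i)"
    if c: "q \<in> carrier R" "p \<in> carrier R" "q' \<in> carrier R" "fraction R s q j = fraction R s p j'" for q p q' j j' i
  proof -
    obtain m :: nat where m: "s [^] m \<otimes> (s [^] j' \<otimes> q) = s [^] m \<otimes> (s [^] j \<otimes> p)"
      using iffD1[OF fraction_eq_iff[OF s c(1,2)] c(4)] by blast
    have "s [^] m \<otimes> (s [^] (j' + i) \<otimes> (q \<otimes> q')) = (s [^] m \<otimes> (s [^] j' \<otimes> q)) \<otimes> (s [^] i \<otimes> q')" using c(1-3) s by (simp add: nat_pow_add m_ac)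
    also have "\<dots> = s [^] m \<otimes> (s [^] (j + i) \<otimes> (p \<otimes> q'))" unfolding m using c(1-3) s by (simp add: nat_pow_add m_ac)
    finally show ?thesis using c(1-3) s by (subst fraction_eq_iff) auto
  qed
  have B: "(\<Union>(q', i)\<in>fraction R s r' l. fraction R s (q \<otimes> q') (j + i)) = fraction R s (q \<otimes> r') (j + l)" if "q \<in> carrier R" for q j
  proof (rule UN_fraction[OF s r(2)])
    fix q' i assume h: "q' \<in> carrier R" "fraction R s q' i = fraction R s r' l"
    show "fraction R s (q \<otimes> q') (j + i) = fraction R s (q \<otimes> r') (j + l)"
      using A[OF h(1) r(2) that h(2), of j] unfolding m_comm[OF h(1) that] m_comm[OF r(2) that] add.commute[of _ j] .
  qed
  have "(\<Union>(q, j)\<in>fraction R s r k. \<Union>(q', i)\<in>fraction R s r' l. fraction R s (q \<otimes> q') (j + i)) = (\<Union>(q', i)\<in>fraction R s r' l. fraction R s (r \<otimes> q') (k + i))"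
    by (rule UN_fraction[OF s r(1)]) (simp only: B r, rule A[OF _ r]; assumption)
  then show ?thesis by (simp add: localization_def B r)
qed

lemma fraction_add:
  assumes s: "s \<in> carrier R" and r: "r \<in> carrier R" "r' \<in> carrier R"
  shows "fraction R s r k \<oplus>\<^bsub>localization R s\<^esub> fraction R s r' l = fraction R s (s [^] l \<otimes> r \<oplus> s [^] k \<otimes> r') (k + l)"
proof -
  have A: "fraction R s (s [^] i \<otimes> q \<oplus> s [^] j \<otimes> q') (j + i) = fraction R s (s [^] i \<otimes> p \<oplus> s [^] j' \<otimes> q') (j' + i)"
    if c: "q \<in> carrier R" "p \<in> carrier R" "q' \<in> carrier R" "fraction R s q j = fraction R s p j'" for q p q' j j' i
  proof -
    obtain m :: nat where m: "s [^] m \<otimes> (s [^] j' \<otimes> q) = s [^] m \<otimes> (s [^] j \<otimes> p)"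
      using iffD1[OF fraction_eq_iff[OF s c(1,2)] c(4)] by blast
    have "s [^] m \<otimes> (s [^] (j' + i) \<otimes> (s [^] i \<otimes> q \<oplus> s [^] j \<otimes> q')) = (s [^] m \<otimes> (s [^] j' \<otimes> q)) \<otimes> (s [^] i \<otimes> s [^] i) \<oplus> s [^] m \<otimes> s [^] j' \<otimes> s [^] i \<otimes> s [^] j \<otimes> q'" using c(1-3) s by (simp add: nat_pow_add m_ac r_distr)
    also have "\<dots> = s [^] m \<otimes> (s [^] (j + i) \<otimes> (s [^] i \<otimes> p \<oplus> s [^] j' \<otimes> q'))" unfolding m using c(1-3) s by (simp add: nat_pow_add m_ac r_distr)
    finally show ?thesis using c(1-3) s by (subst fraction_eq_iff) auto
  qed
  have B: "(\<Union>(q', i)\<in>fraction R s r' l. fraction R s (s [^] i \<otimes> q \<oplus> s [^] j \<otimes> q') (j + i)) = fraction R s (s [^] l \<otimes> q \<oplus> s [^] j \<otimes> r') (j + l)" if "q \<in> carrier R" for q j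
  proof (rule UN_fraction[OF s r(2)])
    fix q' i assume h: "q' \<in> carrier R" "fraction R s q' i = fraction R s r' l"
    have c: "s [^] j \<otimes> z \<oplus> s [^] (i::nat) \<otimes> q = s [^] i \<otimes> q \<oplus> s [^] j \<otimes> z" if "z \<in> carrier R" for z i
      using that \<open>q \<in> carrier R\<close> s by (intro a_comm) auto
    show "fraction R s (s [^] i \<otimes> q \<oplus> s [^] j \<otimes> q') (j + i) = fraction R s (s [^] l \<otimes> q \<oplus> s [^] j \<otimes> r') (j + l)"
      using A[OF h(1) r(2) that h(2), of j] unfolding c[OF h(1)] c[OF r(2)] add.commute[of _ j] .
  qed
  have "(\<Union>(q, j)\<in>fraction R s r k. \<Union>(q', i)\<in>fraction R s r' l. fraction R s (s [^] i \<otimes> q \<oplus> s [^] j \<otimes> q') (j + i)) = (\<Union>(q', i)\<in>fraction R s r' l. fraction R s (s [^] i \<otimes> r \<oplus> s [^] k \<otimes> q') (k + i))"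
    by (rule UN_fraction[OF s r(1)]) (simp only: B r, rule A[OF _ r]; assumption)
  then show ?thesis by (simp add: localization_def B r)
qed

lemma localization_simps: "carrier (localization R s) = {fraction R s r k | r k. r \<in> carrier R}"
   "\<one>\<^bsub>localization R s\<^esub> = fraction R s \<one> 0" "\<zero>\<^bsub>localization R s\<^esub> = fraction R s \<zero> 0"
  by (simp_all add: localization_def)

lemma fraction_l_neg:
  assumes s: "s \<in> carrier R" and r: "r \<in> carrier R"
  shows "fraction R s (\<ominus> r) k \<oplus>\<^bsub>localization R s\<^esub> fraction R s r k = fraction R s \<zero> 0"
  using assms by (subst fraction_add) (auto simp: fraction_eq_iff r_minus l_neg)

lemma localization_cring:
  assumes s: "s \<in> carrier R" shows "cring (localization R s)"
proof -
  have mc: "fraction R s r k \<in> carrier (localization R s)" if "r \<in> carrier R" for r k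
    unfolding localization_simps using that by blast
  show ?thesis
proof (rule cringI)
  show "abelian_group (localization R s)"
  proof (rule abelian_groupI)
    show "\<zero>\<^bsub>localization R s\<^esub> \<in> carrier (localization R s)" by (simp add: localization_simps(3) mc)
  next
    fix x assume "x \<in> carrier (localization R s)"
    then obtain r k where x: "r \<in> carrier R" "x = fraction R s r k" unfolding localization_simps by blast
    show "\<zero>\<^bsub>localization R s\<^esub> \<oplus>\<^bsub>localization R s\<^esub> x = x"
      using x s by (simp add: localization_simps(3) fraction_add)
    show "\<exists>y\<in>carrier (localization R s). y \<oplus>\<^bsub>localization R s\<^esub> x = \<zero>\<^bsub>localization R s\<^esub>"
      unfolding x localization_simps(3) using fraction_l_neg[OF s x(1), of k] mc[of "\<ominus> r" k] x(1) by auto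
    fix y assume "y \<in> carrier (localization R s)"
    then obtain r' k' where y: "r' \<in> carrier R" "y = fraction R s r' k'" unfolding localization_simps by blast
    show "x \<oplus>\<^bsub>localization R s\<^esub> y \<in> carrier (localization R s)"
      unfolding x y using x y s by (auto simp: fraction_add intro!: mc)
    show "x \<oplus>\<^bsub>localization R s\<^esub> y = y \<oplus>\<^bsub>localization R s\<^esub> x"
      unfolding x y fraction_add[OF s x(1) y(1)] fraction_add[OF s y(1) x(1)]
      using x y s by (intro arg_cong2[of _ _ _ _ "fraction R s"] a_comm) auto
    fix z assume "z \<in> carrier (localization R s)"
    then obtain r'' k'' where z: "r'' \<in> carrier R" "z = fraction R s r'' k''" unfolding localization_simps by blast
    show "x \<oplus>\<^bsub>localization R s\<^esub> y \<oplus>\<^bsub>localization R s\<^esub> z = x \<oplus>\<^bsub>localization R s\<^esub> (y \<oplus>\<^bsub>localization R s\<^esub> z)"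
      unfolding x y z using x y z s
      by (simp add: fraction_add) (rule arg_cong2[of _ _ _ _ "fraction R s"]; simp add: nat_pow_add r_distr m_ac a_ac)
  qed
  show "comm_monoid (localization R s)"
  proof (rule comm_monoidI)
    show "\<one>\<^bsub>localization R s\<^esub> \<in> carrier (localization R s)" by (simp add: localization_simps(2) mc)
  next
    fix x assume "x \<in> carrier (localization R s)"
    then obtain r k where x: "r \<in> carrier R" "x = fraction R s r k" unfolding localization_simps by blast
    show "\<one>\<^bsub>localization R s\<^esub> \<otimes>\<^bsub>localization R s\<^esub> x = x"
      using x s by (simp add: localization_simps(2) fraction_mult)
    fix y assume "y \<in> carrier (localization R s)"
    then obtain r' k' where y: "r' \<in> carrier R" "y = fraction R s r' k'" unfolding localization_simps by blast
    show "x \<otimes>\<^bsub>localization R s\<^esub> y \<in> carrier (localization R s)"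
      unfolding x y using x y s by (auto simp: fraction_mult intro!: mc)
    show "x \<otimes>\<^bsub>localization R s\<^esub> y = y \<otimes>\<^bsub>localization R s\<^esub> x"
      unfolding x y fraction_mult[OF s x(1) y(1)] fraction_mult[OF s y(1) x(1)]
      using x y s by (intro arg_cong2[of _ _ _ _ "fraction R s"] m_comm) auto
    fix z assume "z \<in> carrier (localization R s)"
    then obtain r'' k'' where z: "r'' \<in> carrier R" "z = fraction R s r'' k''" unfolding localization_simps by blast
    show "x \<otimes>\<^bsub>localization R s\<^esub> y \<otimes>\<^bsub>localization R s\<^esub> z = x \<otimes>\<^bsub>localization R s\<^esub> (y \<otimes>\<^bsub>localization R s\<^esub> z)"
      unfolding x y z using x y z s
      by (simp add: fraction_mult m_assoc add.assoc)
  qed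
next
  fix x y z assume "x \<in> carrier (localization R s)" "y \<in> carrier (localization R s)" "z \<in> carrier (localization R s)"
  then show "(x \<oplus>\<^bsub>localization R s\<^esub> y) \<otimes>\<^bsub>localization R s\<^esub> z =
       x \<otimes>\<^bsub>localization R s\<^esub> z \<oplus>\<^bsub>localization R s\<^esub> y \<otimes>\<^bsub>localization R s\<^esub> z"
    unfolding localization_simps
    apply (clarsimp simp: fraction_add fraction_mult s)
    apply (subst fraction_eq_iff)
    using s by (auto simp: nat_pow_add r_distr l_distr m_ac)
qed
qed
end

lemma localization_map_fraction:
  assumes "cring C" "subcring B C" "s \<in> B" "r \<in> B"
  shows "localization_map C s (fraction (C\<lparr>carrier := B\<rparr>) s r k) = fraction C s r k"
proof -
  interpret C: cring C by fact
  interpret B: cring "C\<lparr>carrier := B\<rparr>" using C.subcring_iff assms(2) subcringE(1) by blast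
  have BC: "B \<subseteq> carrier C" using assms(2) subcringE(1) by blast
  have pow: "s [^]\<^bsub>C\<lparr>carrier := B\<rparr>\<^esub> (k::nat) = s [^]\<^bsub>C\<^esub> k" for k
    by (simp add: nat_pow_def)
  show ?thesis unfolding localization_map_def
  proof (rule B.UN_fraction)
    fix r' l assume "r' \<in> carrier (C\<lparr>carrier := B\<rparr>)" "fraction (C\<lparr>carrier := B\<rparr>) s r' l = fraction (C\<lparr>carrier := B\<rparr>) s r k"
    then show "fraction C s r' l = fraction C s r k"
      using assms BC by (subst C.fraction_eq_iff) (auto simp: B.fraction_eq_iff pow)
  qed (use assms in auto)
qed

lemma localization_map_hom:
  assumes "cring C" "subcring B C" "s \<in> B"
  shows "localization_map C s \<in> ring_hom (localization (C\<lparr>carrier := B\<rparr>) s) (localization C s)"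
   and "inj_on (localization_map C s) (carrier (localization (C\<lparr>carrier := B\<rparr>) s))"
proof -
  interpret C: cring C by fact
  interpret B: cring "C\<lparr>carrier := B\<rparr>" using C.subcring_iff assms(2) subcringE(1) by blast
  have BC: "B \<subseteq> carrier C" using assms(2) subcringE(1) by blast
  then have s: "s \<in> carrier C" "s \<in> carrier (C\<lparr>carrier := B\<rparr>)" using assms by auto
  have pow: "s [^]\<^bsub>C\<lparr>carrier := B\<rparr>\<^esub> (k::nat) = s [^]\<^bsub>C\<^esub> k" for k
    by (simp add: nat_pow_def)
  note f = localization_map_fraction[OF assms]
  have cl: "a \<otimes>\<^bsub>C\<^esub> b \<in> B" "a \<oplus>\<^bsub>C\<^esub> b \<in> B" "s [^]\<^bsub>C\<^esub> (k::nat) \<in> B" "\<one>\<^bsub>C\<^esub> \<in> B" if "a \<in> B" "b \<in> B" for a b k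
    using B.m_closed[of a b] B.a_closed[of a b] B.nat_pow_closed[OF s(2), of k] that B.one_closed unfolding pow by auto
  have m: "fraction (C\<lparr>carrier := B\<rparr>) s a i \<otimes>\<^bsub>localization (C\<lparr>carrier := B\<rparr>) s\<^esub> fraction (C\<lparr>carrier := B\<rparr>) s b j
     = fraction (C\<lparr>carrier := B\<rparr>) s (a \<otimes>\<^bsub>C\<^esub> b) (i + j)" if "a \<in> B" "b \<in> B" for a b i j
    using B.fraction_mult[OF s(2), of a b] that by simp
  have p: "fraction (C\<lparr>carrier := B\<rparr>) s a i \<oplus>\<^bsub>localization (C\<lparr>carrier := B\<rparr>) s\<^esub> fraction (C\<lparr>carrier := B\<rparr>) s b j
     = fraction (C\<lparr>carrier := B\<rparr>) s (s [^]\<^bsub>C\<^esub> j \<otimes>\<^bsub>C\<^esub> a \<oplus>\<^bsub>C\<^esub> s [^]\<^bsub>C\<^esub> i \<otimes>\<^bsub>C\<^esub> b) (i + j)" if "a \<in> B" "b \<in> B" for a b i j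
    using B.fraction_add[OF s(2), of a b] that by (simp add: pow)
  show "localization_map C s \<in> ring_hom (localization (C\<lparr>carrier := B\<rparr>) s) (localization C s)"
  proof (rule ring_hom_memI)
    fix x assume "x \<in> carrier (localization (C\<lparr>carrier := B\<rparr>) s)"
    then obtain r k where x: "r \<in> B" "x = fraction (C\<lparr>carrier := B\<rparr>) s r k" unfolding B.localization_simps by auto
    have xC: "r \<in> carrier C" using x BC by blast
    show "localization_map C s x \<in> carrier (localization C s)" unfolding x f[OF x(1)] C.localization_simps using xC by blast
    fix y assume "y \<in> carrier (localization (C\<lparr>carrier := B\<rparr>) s)"
    then obtain r' l where y: "r' \<in> B" "y = fraction (C\<lparr>carrier := B\<rparr>) s r' l" unfolding B.localization_simps by auto
    have yC: "r' \<in> carrier C" using y BC by blast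
    show "localization_map C s (x \<otimes>\<^bsub>localization (C\<lparr>carrier := B\<rparr>) s\<^esub> y) = localization_map C s x \<otimes>\<^bsub>localization C s\<^esub> localization_map C s y"
      unfolding x y m[OF x(1) y(1)] using cl x y by (simp add: f C.fraction_mult[OF s(1) xC yC])
    show "localization_map C s (x \<oplus>\<^bsub>localization (C\<lparr>carrier := B\<rparr>) s\<^esub> y) = localization_map C s x \<oplus>\<^bsub>localization C s\<^esub> localization_map C s y"
      unfolding x y p[OF x(1) y(1)] using cl x y by (simp add: f C.fraction_add[OF s(1) xC yC])
  next
    show "localization_map C s \<one>\<^bsub>localization (C\<lparr>carrier := B\<rparr>) s\<^esub> = \<one>\<^bsub>localization C s\<^esub>"
      unfolding B.localization_simps C.localization_simps using f[of "\<one>\<^bsub>C\<^esub>" 0] cl(4) assms by auto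
  qed
  show "inj_on (localization_map C s) (carrier (localization (C\<lparr>carrier := B\<rparr>) s))"
  proof (rule inj_onI)
    fix x y assume "x \<in> carrier (localization (C\<lparr>carrier := B\<rparr>) s)" "y \<in> carrier (localization (C\<lparr>carrier := B\<rparr>) s)" and e: "localization_map C s x = localization_map C s y"
    then obtain r k r' l where x: "r \<in> B" "x = fraction (C\<lparr>carrier := B\<rparr>) s r k" and y: "r' \<in> B" "y = fraction (C\<lparr>carrier := B\<rparr>) s r' l" unfolding B.localization_simps by auto
    have c: "r \<in> carrier C" "r' \<in> carrier C" using x y BC by auto
    have "\<exists>m::nat. s [^]\<^bsub>C\<^esub> m \<otimes>\<^bsub>C\<^esub> (s [^]\<^bsub>C\<^esub> l \<otimes>\<^bsub>C\<^esub> r) = s [^]\<^bsub>C\<^esub> m \<otimes>\<^bsub>C\<^esub> (s [^]\<^bsub>C\<^esub> k \<otimes>\<^bsub>C\<^esub> r')"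
      using e unfolding x y f[OF x(1)] f[OF y(1)] C.fraction_eq_iff[OF s(1) c] .
    then show "x = y" unfolding x y using B.fraction_eq_iff[OF s(2), of r r' k l] x y by (simp add: pow)
  qed
qed

subsection \<open>The extension\<close>

lemma module_via_hom_algebra:
  assumes "cring B" "cring C" "h \<in> ring_hom B C"
  shows "algebra B (module_via_hom h C)"
proof -
  interpret B: cring B by fact
  interpret C: cring C by fact
  have "cring (module_via_hom h C)"
    by (intro cringI abelian_groupI comm_monoidI)
      (auto simp: module_via_hom_def C.m_ac C.a_ac C.r_distr intro: C.l_neg)
  then show ?thesis
    by (rule algebraI[OF assms(1)])
      (use assms(3) in \<open>auto simp: module_via_hom_def ring_hom_closed ring_hom_mult ring_hom_add
        ring_hom_one C.l_distr C.r_distr C.m_assoc\<close>)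
qed

context algebra begin

lemma TS_extension:
  assumes x: "x \<in> {1..n} \<rightarrow> carrier M"
  defines "s \<equiv> alternating_square R M n x"
  shows "algebra (localization (TS R M n) s)
      (module_via_hom (localization_map (TS_last R M n) s) (localization (TS_last R M n) s))"
    and "inj_on (localization_map (TS_last R M n) s) (carrier (localization (TS R M n) s))"
proof -
  interpret T: cring "tensor_power R M n" by (rule tensor_power_cring)
  let ?B = "carrier (TS R M n)" and ?C = "TS_last R M n"
  have eq: "?C\<lparr>carrier := ?B\<rparr> = TS R M n"
    by (simp add: TS_def TS_last_def tensor_invariants_def)
  have eqB: "(tensor_power R M n)\<lparr>carrier := ?B\<rparr> = TS R M n"
    and eqC: "(tensor_power R M n)\<lparr>carrier := carrier ?C\<rparr> = ?C"
    by (simp_all add: TS_def TS_last_def tensor_invariants_def)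
  have sB: "subcring ?B (tensor_power R M n)" and sC: "subcring (carrier ?C) (tensor_power R M n)"
    by (auto simp: TS_def TS_last_def intro!: tensor_invariants_subcring)
  have B: "cring (TS R M n)"
    using T.subcring_iff[OF subcringE(1)[OF sB]] sB eqB by simp
  have C: "cring ?C"
    using T.subcring_iff[OF subcringE(1)[OF sC]] sC eqC by simp
  have sub: "?B \<subseteq> carrier ?C"
  proof -
    have "\<sigma> permutes {1..n}" if "\<sigma> permutes {1..n - 1}" for \<sigma>
      by (rule permutes_subset[OF that]) auto
    then show ?thesis unfolding TS_def TS_last_def tensor_invariants_def by auto
  qed
  interpret C: cring ?C by (rule C)
  have BC: "subcring ?B ?C"
    using C.subcring_iff[OF sub] B eq by simp
  have s: "s \<in> ?B" unfolding s_def by (rule alternating_square_mem[OF x])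
  then have s': "s \<in> carrier ?C" using sub by blast
  note h = localization_map_hom[OF C BC s, unfolded eq]
  show "algebra (localization (TS R M n) s)
      (module_via_hom (localization_map ?C s) (localization ?C s))"
    by (intro module_via_hom_algebra h(1) cring.localization_cring B C s s')
  show "inj_on (localization_map ?C s) (carrier (localization (TS R M n) s))"
    by (rule h(2))
qed

end

end

theory Submission
  imports Defs
begin

text \<open>
  The alternating tensor \<open>\<alpha>\<close> is the determinant of the matrix \<open>\<phi>\<^sub>p(x\<^sub>i)\<close>, whose rows \<open>p\<close> are permuted
  by the symmetric group. Let \<open>y\<close> be invariant under permutations of the first \<open>n - 1\<close> factors, with
  conjugates \<open>y\<^sub>1, \<dots>, y\<^sub>n = y\<close>. Cramer's rule expresses \<open>\<alpha> y\<close> as the combination of the \<open>\<phi>\<^sub>n(x\<^sub>i)\<close>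
  whose coefficients \<open>D\<^sub>i\<close> are the determinants with column \<open>i\<close> replaced by the conjugates; these are
  alternating, so the coefficients \<open>\<alpha> D\<^sub>i\<close> of \<open>\<alpha>\<^sup>2 y\<close> are symmetric. Conversely, a vanishing combination
  of the \<open>\<phi>\<^sub>n(x\<^sub>i)\<close> with symmetric coefficients also vanishes with \<open>\<phi>\<^sub>p\<close> in place of \<open>\<phi>\<^sub>n\<close> for every
  \<open>p\<close>, so the determinant \<open>\<alpha>\<close> kills its coefficients.
\<close>

section \<open>Determinants over a commutative ring\<close>

text \<open>The Leibniz determinant, with rows and columns indexed by the same set and the row index
  first. Signs act as integer multiples, the form in which they occur in
  \<open>alternating_tensor\<close>.\<close>

definition perm_det :: "('a, 'm) ring_scheme \<Rightarrow> 'i set \<Rightarrow> ('i \<Rightarrow> 'i \<Rightarrow> 'a) \<Rightarrow> 'a" where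
  "perm_det R I a =
    (\<Oplus>\<^bsub>R\<^esub>\<sigma>\<in>{\<sigma>. \<sigma> permutes I}. [sign \<sigma>] \<cdot>\<^bsub>R\<^esub> (\<Otimes>\<^bsub>R\<^esub>p\<in>I. a p (\<sigma> p)))"

context cring begin

section \<open>Signs as integer multiples, and finite sums\<close>

lemma add_pow_sign_closed: "X \<in> carrier R \<Longrightarrow> [sign \<sigma>] \<cdot> X \<in> carrier R"
  by (rule add.int_pow_closed)

lemma add_pow_sign_mult:
  assumes "X \<in> carrier R" "Y \<in> carrier R"
  shows "[sign \<sigma>] \<cdot> (X \<otimes> Y) = X \<otimes> ([sign \<sigma>] \<cdot> Y)" "[sign \<sigma>] \<cdot> (X \<otimes> Y) = [sign \<sigma>] \<cdot> X \<otimes> Y"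
  using assms by (cases \<sigma> rule: sign_cases; simp add: add.int_pow_neg r_minus l_minus)+

lemma add_pow_sign_compose:
  assumes "permutation \<sigma>" "permutation \<tau>" "X \<in> carrier R"
  shows "[sign (\<sigma> \<circ> \<tau>)] \<cdot> X = [sign \<tau>] \<cdot> ([sign \<sigma>] \<cdot> X)"
  using assms
  by (cases \<sigma> rule: sign_cases; cases \<tau> rule: sign_cases; simp add: sign_compose add.int_pow_neg)

lemma add_pow_sign_finsum:
  assumes "f \<in> S \<rightarrow> carrier R"
  shows "[sign \<sigma>] \<cdot> (\<Oplus>i\<in>S. f i) = (\<Oplus>i\<in>S. [sign \<sigma>] \<cdot> f i)"
proof -
  \<comment> \<open>A sign multiple is multiplication by this ring element, so it passes through a
    finite sum by distributivity.\<close>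
  let ?e = "[sign \<sigma>] \<cdot> \<one>"
  have e: "[sign \<sigma>] \<cdot> X = ?e \<otimes> X" if "X \<in> carrier R" for X
    using add_pow_sign_mult(2)[of \<one> X \<sigma>] that by simp
  show ?thesis
  proof (cases "finite S")
    case True
    have "[sign \<sigma>] \<cdot> (\<Oplus>i\<in>S. f i) = ?e \<otimes> (\<Oplus>i\<in>S. f i)"
      using assms by (intro e finsum_closed)
    also have "\<dots> = (\<Oplus>i\<in>S. ?e \<otimes> f i)"
      using assms True by (intro finsum_rdistr) (auto intro: add_pow_sign_closed)
    also have "\<dots> = (\<Oplus>i\<in>S. [sign \<sigma>] \<cdot> f i)"
      using assms by (intro finsum_cong') (auto simp: e[symmetric] Pi_iff intro: add_pow_sign_closed)
    finally show ?thesis .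
  next
    \<comment> \<open>A sum over an infinite set is \<zero> by convention, so both sides
      vanish.\<close>
    case False
    then show ?thesis by (simp add: finsum_infinite)
  qed
qed

lemma finsum_swap:
  assumes "finite S" "finite U" "\<And>i j. i \<in> S \<Longrightarrow> j \<in> U \<Longrightarrow> f i j \<in> carrier R"
  shows "(\<Oplus>i\<in>S. \<Oplus>j\<in>U. f i j) = (\<Oplus>j\<in>U. \<Oplus>i\<in>S. f i j)"
  using assms(1,3)
proof (induction S rule: finite_induct)
  case empty
  then show ?case by simp
next
  case (insert k S)
  have "(\<Oplus>j\<in>U. \<Oplus>i\<in>insert k S. f i j) = (\<Oplus>j\<in>U. f k j \<oplus> (\<Oplus>i\<in>S. f i j))"
    using insert by (intro finsum_cong') (auto intro!: finsum_closed)
  also have "\<dots> = (\<Oplus>j\<in>U. f k j) \<oplus> (\<Oplus>j\<in>U. \<Oplus>i\<in>S. f i j)"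
    using insert by (intro finsum_addf) (auto intro!: finsum_closed)
  finally show ?case using insert by (auto intro!: finsum_closed)
qed

section \<open>Symmetries of the Leibniz determinant\<close>

lemma perm_det_term_closed:
  assumes "a \<in> I \<rightarrow> I \<rightarrow> carrier R" "\<sigma> permutes I"
  shows "[sign \<sigma>] \<cdot> (\<Otimes>p\<in>I. a p (\<sigma> p)) \<in> carrier R"
  using assms permutes_in_image[OF assms(2)]
  by (intro add_pow_sign_closed finprod_closed) auto

lemma perm_det_closed: "a \<in> I \<rightarrow> I \<rightarrow> carrier R \<Longrightarrow> perm_det R I a \<in> carrier R"
  unfolding perm_det_def by (intro finsum_closed) (auto intro: perm_det_term_closed)

lemma perm_det_cong:
  assumes "b \<in> I \<rightarrow> I \<rightarrow> carrier R" "\<And>p i. p \<in> I \<Longrightarrow> i \<in> I \<Longrightarrow> a p i = b p i"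
  shows "perm_det R I a = perm_det R I b"
  unfolding perm_det_def
proof (rule finsum_cong'[OF refl])
  fix \<sigma> assume "\<sigma> \<in> {\<sigma>. \<sigma> permutes I}"
  then have s: "\<sigma> permutes I" by simp
  have "(\<Otimes>p\<in>I. a p (\<sigma> p)) = (\<Otimes>p\<in>I. b p (\<sigma> p))"
    using assms permutes_in_image[OF s] by (intro finprod_cong') (auto simp: Pi_iff)
  then show "[sign \<sigma>] \<cdot> (\<Otimes>p\<in>I. a p (\<sigma> p)) = [sign \<sigma>] \<cdot> (\<Otimes>p\<in>I. b p (\<sigma> p))" by simp
qed (use assms(1) in \<open>auto intro: perm_det_term_closed\<close>)

lemma finprod_permutes:
  assumes "f \<in> I \<rightarrow> carrier R" "\<tau> permutes I"
  shows "(\<Otimes>p\<in>I. f (\<tau> p)) = (\<Otimes>p\<in>I. f p)"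
  using finprod_reindex[of f \<tau> I] assms by (simp add: permutes_image permutes_inj_on)

text \<open>Replacing the summation index \<sigma> by \<open>\<sigma> \<circ> \<tau>\<close>
  multiplies the sign by that of \<tau>, and reindexing the rows along \<tau> restores the original
  product.\<close>

lemma perm_det_permute_rows:
  assumes I: "finite I" and a: "a \<in> I \<rightarrow> I \<rightarrow> carrier R" and t: "\<tau> permutes I"
  shows "perm_det R I (\<lambda>p. a (\<tau> p)) = [sign \<tau>] \<cdot> perm_det R I a"
proof -
  let ?S = "{\<sigma>. \<sigma> permutes I}"
  let ?f = "\<lambda>\<sigma>. [sign \<tau>] \<cdot> ([sign \<sigma>] \<cdot> (\<Otimes>p\<in>I. a p (\<sigma> p)))"
  have perm: "permutation \<sigma>" if "\<sigma> permutes I" for \<sigma>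
    using I that permutation_permutes by blast
  have fc: "?f \<in> ?S \<rightarrow> carrier R"
    using perm_det_term_closed[OF a] by (simp add: add_pow_sign_closed)
  have "[sign (\<sigma> \<circ> \<tau>)] \<cdot> (\<Otimes>p\<in>I. a (\<tau> p) ((\<sigma> \<circ> \<tau>) p)) = ?f \<sigma>" if s: "\<sigma> permutes I" for \<sigma>
  proof -
    have "(\<Otimes>p\<in>I. a (\<tau> p) ((\<sigma> \<circ> \<tau>) p)) = (\<Otimes>p\<in>I. a p (\<sigma> p))"
      using finprod_permutes[of "\<lambda>p. a p (\<sigma> p)" I \<tau>] a t permutes_in_image[OF s] by (auto simp: Pi_iff)
    moreover have "(\<Otimes>p\<in>I. a p (\<sigma> p)) \<in> carrier R"
      using a permutes_in_image[OF s] by (intro finprod_closed) auto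
    ultimately show ?thesis using s t perm by (simp add: add_pow_sign_compose)
  qed
  note eq = this
  have "perm_det R I (\<lambda>p. a (\<tau> p)) =
      (\<Oplus>\<sigma>\<in>(\<lambda>\<sigma>. \<sigma> \<circ> \<tau>) ` ?S. [sign \<sigma>] \<cdot> (\<Otimes>p\<in>I. a (\<tau> p) (\<sigma> p)))"
    unfolding perm_det_def image_compose_permutations_right[OF t, unfolded setcompr_eq_image] ..
  also have "\<dots> = (\<Oplus>\<sigma>\<in>?S. [sign (\<sigma> \<circ> \<tau>)] \<cdot> (\<Otimes>p\<in>I. a (\<tau> p) ((\<sigma> \<circ> \<tau>) p)))"
  proof (rule finsum_reindex)
    have "(\<lambda>p. a (\<tau> p)) \<in> I \<rightarrow> I \<rightarrow> carrier R"
      using a permutes_in_image[OF t] by auto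
    then show "(\<lambda>\<sigma>. [sign \<sigma>] \<cdot> (\<Otimes>p\<in>I. a (\<tau> p) (\<sigma> p))) \<in> (\<lambda>\<sigma>. \<sigma> \<circ> \<tau>) ` ?S \<rightarrow> carrier R"
      using permutes_compose[OF t] by (auto intro!: perm_det_term_closed)
    show "inj_on (\<lambda>\<sigma>. \<sigma> \<circ> \<tau>) ?S"
      by (rule inj_onI) (metis (no_types) permutes_inv_o(1)[OF t] comp_assoc comp_id)
  qed
  also have "\<dots> = (\<Oplus>\<sigma>\<in>?S. ?f \<sigma>)"
    using fc by (intro finsum_cong') (simp_all only: eq mem_Collect_eq)
  also have "\<dots> = [sign \<tau>] \<cdot> perm_det R I a"
    unfolding perm_det_def
    using a by (intro add_pow_sign_finsum[symmetric]) (auto intro: perm_det_term_closed)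
  finally show ?thesis .
qed

text \<open>Inversion of permutations preserves signs, and reindexing the product for the inverse of
  \<sigma> along \<sigma> turns its column indices into row indices.\<close>

lemma perm_det_transpose:
  assumes I: "finite I" and a: "a \<in> I \<rightarrow> I \<rightarrow> carrier R"
  shows "perm_det R I (\<lambda>p i. a i p) = perm_det R I a"
proof -
  let ?S = "{\<sigma>. \<sigma> permutes I}"
  have aT: "(\<lambda>p i. a i p) \<in> I \<rightarrow> I \<rightarrow> carrier R" using a by auto
  have S: "inv_into UNIV ` ?S = ?S"
    using image_inverse_permutations[of I] by (simp add: setcompr_eq_image)
  have "perm_det R I (\<lambda>p i. a i p) = (\<Oplus>\<sigma>\<in>inv_into UNIV ` ?S. [sign \<sigma>] \<cdot> (\<Otimes>p\<in>I. a (\<sigma> p) p))"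
    unfolding perm_det_def S ..
  also have "\<dots> = (\<Oplus>\<sigma>\<in>?S. [sign (inv_into UNIV \<sigma>)] \<cdot> (\<Otimes>p\<in>I. a (inv_into UNIV \<sigma> p) p))"
  proof (rule finsum_reindex)
    show "(\<lambda>\<sigma>. [sign \<sigma>] \<cdot> (\<Otimes>p\<in>I. a (\<sigma> p) p)) \<in> inv_into UNIV ` ?S \<rightarrow> carrier R"
      unfolding S using perm_det_term_closed[OF aT] by simp
    show "inj_on (inv_into UNIV) ?S"
      by (rule inj_onI) (metis mem_Collect_eq permutes_inv_inv)
  qed
  also have "\<dots> = perm_det R I a"
    unfolding perm_det_def
  proof (rule finsum_cong'[OF refl])
    fix \<sigma> assume "\<sigma> \<in> ?S"
    then have s: "\<sigma> permutes I" by simp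
    have perm: "permutation \<sigma>" using I s permutation_permutes by blast
    have "(\<Otimes>p\<in>I. a (inv_into UNIV \<sigma> p) p) = (\<Otimes>p\<in>I. a (inv_into UNIV \<sigma> (\<sigma> p)) (\<sigma> p))"
      using a permutes_in_image[OF permutes_inv[OF s]] s
      by (intro finprod_permutes[symmetric]) auto
    then show "[sign (inv_into UNIV \<sigma>)] \<cdot> (\<Otimes>p\<in>I. a (inv_into UNIV \<sigma> p) p) =
        [sign \<sigma>] \<cdot> (\<Otimes>p\<in>I. a p (\<sigma> p))"
      using permutes_inverses(2)[OF s] sign_inverse[OF perm] by simp
  qed (use a in \<open>auto intro: perm_det_term_closed\<close>)
  finally show ?thesis .
qed

text \<open>Antisymmetry alone would only show that twice the determinant vanishes. Instead,
  composition with the transposition of \<open>p\<close> and \<open>q\<close> pairs each even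
  permutation with an odd one, and the two terms of a pair cancel; this is valid in every
  characteristic.\<close>

lemma perm_det_equal_rows:
  assumes I: "finite I" and a: "a \<in> I \<rightarrow> I \<rightarrow> carrier R"
    and pq: "p \<in> I" "q \<in> I" "p \<noteq> q" and eq: "\<And>i. i \<in> I \<Longrightarrow> a p i = a q i"
  shows "perm_det R I a = \<zero>"
proof -
  let ?t = "transpose p q"
  let ?E = "{\<sigma>. \<sigma> permutes I \<and> evenperm \<sigma>}" and ?O = "{\<sigma>. \<sigma> permutes I \<and> \<not> evenperm \<sigma>}"
  let ?f = "\<lambda>\<sigma>. [sign \<sigma>] \<cdot> (\<Otimes>p\<in>I. a p (\<sigma> p))"
  have t: "?t permutes I" using pq by (simp add: permutes_swap_id)
  have perm: "permutation \<sigma>" if "\<sigma> permutes I" for \<sigma>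
    using I that permutation_permutes by blast
  have tt: "(\<sigma> \<circ> ?t) \<circ> ?t = \<sigma>" for \<sigma> :: "'c \<Rightarrow> 'c" by (simp add: comp_assoc)
  have ev: "evenperm (\<sigma> \<circ> ?t) \<longleftrightarrow> \<not> evenperm \<sigma>" if "\<sigma> permutes I" for \<sigma>
    using perm[OF that] perm[OF t] pq by (simp add: evenperm_comp evenperm_swap)
  have fin: "finite ?E" "finite ?O"
    using finite_permutations[OF I] by (auto intro: rev_finite_subset)
  have fc: "?f \<sigma> \<in> carrier R" if "\<sigma> permutes I" for \<sigma> using perm_det_term_closed[OF a that] .
  have O: "?O = (\<lambda>\<sigma>. \<sigma> \<circ> ?t) ` ?E"
  proof
    show "?O \<subseteq> (\<lambda>\<sigma>. \<sigma> \<circ> ?t) ` ?E"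
    proof
      fix \<sigma> assume "\<sigma> \<in> ?O"
      then have "\<sigma> \<circ> ?t \<in> ?E" using ev permutes_compose[OF t] by blast
      then show "\<sigma> \<in> (\<lambda>\<sigma>. \<sigma> \<circ> ?t) ` ?E" using tt[of \<sigma>] by (metis (no_types, lifting) image_eqI)
    qed
  qed (use ev permutes_compose[OF t] in blast)
  have neg: "?f (\<sigma> \<circ> ?t) = \<ominus> ?f \<sigma>" if s: "\<sigma> permutes I" for \<sigma>
  proof -
    \<comment> \<open>The two rows agree, so the row index of each factor may be passed through
      \<open>?t\<close>; reindexing along \<open>?t\<close> then leaves the product belonging to
      \<sigma>.\<close>
    have "(\<Otimes>p\<in>I. a p ((\<sigma> \<circ> ?t) p)) = (\<Otimes>p\<in>I. a (?t p) (\<sigma> (?t p)))"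
      using a eq pq permutes_in_image[OF t] permutes_in_image[OF s]
      by (intro finprod_cong') (auto simp: Pi_iff transpose_def)
    also have "\<dots> = (\<Otimes>p\<in>I. a p (\<sigma> p))"
      using a permutes_in_image[OF s] t by (intro finprod_permutes) auto
    finally have p: "(\<Otimes>p\<in>I. a p ((\<sigma> \<circ> ?t) p)) = (\<Otimes>p\<in>I. a p (\<sigma> p))" .
    have "(\<Otimes>p\<in>I. a p (\<sigma> p)) \<in> carrier R"
      using a permutes_in_image[OF s] by (intro finprod_closed) auto
    then show ?thesis unfolding p using perm[OF s] perm[OF t] pq
      by (simp add: add_pow_sign_compose sign_swap_id add.int_pow_neg add_pow_sign_closed)
  qed
  have "perm_det R I a = (\<Oplus>\<sigma>\<in>?E \<union> ?O. ?f \<sigma>)"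
    unfolding perm_det_def by (rule arg_cong[of _ _ "finsum R ?f"]) auto
  also have "\<dots> = (\<Oplus>\<sigma>\<in>?E. ?f \<sigma>) \<oplus> (\<Oplus>\<sigma>\<in>?O. ?f \<sigma>)"
    using fin fc by (intro finsum_Un_disjoint) auto
  also have "(\<Oplus>\<sigma>\<in>?O. ?f \<sigma>) = (\<Oplus>\<sigma>\<in>?E. ?f (\<sigma> \<circ> ?t))"
    unfolding O
  proof (rule finsum_reindex)
    show "?f \<in> (\<lambda>\<sigma>. \<sigma> \<circ> ?t) ` ?E \<rightarrow> carrier R" using fc permutes_compose[OF t] by blast
    show "inj_on (\<lambda>\<sigma>. \<sigma> \<circ> ?t) ?E" by (rule inj_onI) (metis tt)
  qed
  also have "(\<Oplus>\<sigma>\<in>?E. ?f \<sigma>) \<oplus> (\<Oplus>\<sigma>\<in>?E. ?f (\<sigma> \<circ> ?t)) = (\<Oplus>\<sigma>\<in>?E. ?f \<sigma> \<oplus> ?f (\<sigma> \<circ> ?t))"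
    using fc permutes_compose[OF t] by (intro finsum_addf[symmetric] funcsetI) blast+
  also have "\<dots> = (\<Oplus>\<sigma>\<in>?E. \<zero>)"
    using neg fc by (intro finsum_cong') (auto simp: r_neg)
  finally show ?thesis by simp
qed

section \<open>Expansion along a row, Cramer's rule and the kernel\<close>

lemma perm_det_term_split:
  assumes I: "finite I" and k: "k \<in> I" and s: "\<sigma> permutes I" and a: "a \<in> I \<rightarrow> I \<rightarrow> carrier R"
  shows "[sign \<sigma>] \<cdot> (\<Otimes>p\<in>I. a p (\<sigma> p)) =
    a k (\<sigma> k) \<otimes> ([sign \<sigma>] \<cdot> (\<Otimes>p\<in>I - {k}. a p (\<sigma> p)))"
proof -
  have c: "a p (\<sigma> p) \<in> carrier R" if "p \<in> I" for p
    using a that permutes_in_image[OF s] by auto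
  have "(\<Otimes>p\<in>insert k (I - {k}). a p (\<sigma> p)) = a k (\<sigma> k) \<otimes> (\<Otimes>p\<in>I - {k}. a p (\<sigma> p))"
    using I k c by (intro finprod_insert) auto
  then have "(\<Otimes>p\<in>I. a p (\<sigma> p)) = a k (\<sigma> k) \<otimes> (\<Otimes>p\<in>I - {k}. a p (\<sigma> p))"
    using k by (simp add: insert_absorb)
  moreover have "(\<Otimes>p\<in>I - {k}. a p (\<sigma> p)) \<in> carrier R"
    using c by (intro finprod_closed) auto
  ultimately show ?thesis using add_pow_sign_mult(1) c[OF k] by simp
qed

text \<open>Linearity in row \<open>k\<close>: the factors from the other rows do not involve
  \<open>r\<close>. The cofactors stay expanded over permutations, so that this sum can be
  interchanged with others.\<close>

lemma perm_det_replace_row: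
  assumes I: "finite I" and k: "k \<in> I" and a: "a \<in> I \<rightarrow> I \<rightarrow> carrier R" and r: "r \<in> I \<rightarrow> carrier R"
  shows "perm_det R I (a(k := r)) =
    (\<Oplus>\<sigma>\<in>{\<sigma>. \<sigma> permutes I}. r (\<sigma> k) \<otimes> ([sign \<sigma>] \<cdot> (\<Otimes>p\<in>I - {k}. a p (\<sigma> p))))"
  unfolding perm_det_def
proof (rule finsum_cong'[OF refl])
  have a': "a(k := r) \<in> I \<rightarrow> I \<rightarrow> carrier R" using a r by (auto simp: Pi_iff)
  have c: "(\<Otimes>p\<in>I - {k}. a p (\<sigma> p)) \<in> carrier R" "r (\<sigma> k) \<in> carrier R" if s: "\<sigma> permutes I" for \<sigma>
    using a r k permutes_in_image[OF s] by (auto intro!: finprod_closed)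
  then show "(\<lambda>\<sigma>. r (\<sigma> k) \<otimes> ([sign \<sigma>] \<cdot> (\<Otimes>p\<in>I - {k}. a p (\<sigma> p)))) \<in> {\<sigma>. \<sigma> permutes I} \<rightarrow> carrier R"
    by (auto intro!: add_pow_sign_closed)
  fix \<sigma> assume "\<sigma> \<in> {\<sigma>. \<sigma> permutes I}"
  then have s: "\<sigma> permutes I" by simp
  have "(\<Otimes>p\<in>I - {k}. (a(k := r)) p (\<sigma> p)) = (\<Otimes>p\<in>I - {k}. a p (\<sigma> p))"
    using a permutes_in_image[OF s] by (intro finprod_cong') auto
  then show "[sign \<sigma>] \<cdot> (\<Otimes>p\<in>I. (a(k := r)) p (\<sigma> p)) =
      r (\<sigma> k) \<otimes> ([sign \<sigma>] \<cdot> (\<Otimes>p\<in>I - {k}. a p (\<sigma> p)))"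
    using perm_det_term_split[OF I k s a'] by simp
qed

lemma finsum_delta:
  assumes "finite I" "q \<in> I" "f \<in> I \<rightarrow> carrier R" "\<And>k. k \<in> I \<Longrightarrow> k \<noteq> q \<Longrightarrow> f k = \<zero>"
  shows "(\<Oplus>k\<in>I. f k) = f q"
proof -
  have "(\<Oplus>k\<in>I. f k) = (\<Oplus>k\<in>I. if q = k then f k else \<zero>)"
    using assms by (intro finsum_cong') auto
  then show ?thesis using finsum_singleton[OF assms(2,1,3)] by simp
qed

text \<open>For \<open>k\<close> different from \<open>q\<close> the new matrix has a repeated row.
  This Kronecker delta makes the sums in Cramer's rule and in the kernel argument collapse.\<close>

lemma perm_det_replace_row_by_row:
  assumes I: "finite I" and a: "a \<in> I \<rightarrow> I \<rightarrow> carrier R" and kq: "k \<in> I" "q \<in> I"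
  shows "perm_det R I (a(k := a q)) = (if k = q then perm_det R I a else \<zero>)"
proof (cases "k = q")
  case False
  then show ?thesis
    using perm_det_equal_rows[OF I _ kq False, of "a(k := a q)"] a kq by (auto simp: Pi_iff)
qed simp

text \<open>
  Expanding the left-hand side over permutations and collecting the coefficient of each \<open>y k\<close>
  gives the determinant with row \<open>k\<close> overwritten by row \<open>q\<close>, which vanishes unless \<open>k = q\<close>.
\<close>

lemma perm_det_cramer:
  assumes I: "finite I" and a: "a \<in> I \<rightarrow> I \<rightarrow> carrier R" and y: "y \<in> I \<rightarrow> carrier R" and q: "q \<in> I"
  shows "(\<Oplus>i\<in>I. perm_det R I (\<lambda>p. (a p)(i := y p)) \<otimes> a q i) = perm_det R I a \<otimes> y q"
proof -
  let ?S = "{\<sigma>. \<sigma> permutes I}"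
  let ?N = "\<lambda>i p. (a p)(i := y p)"
  let ?m = "\<lambda>\<sigma> k. [sign \<sigma>] \<cdot> (\<Otimes>p\<in>I - {k}. a p (\<sigma> p))"
  have fS: "finite ?S" using finite_permutations[OF I] .
  have N: "?N i \<in> I \<rightarrow> I \<rightarrow> carrier R" for i using a y by (auto simp: Pi_iff)
  have in_I: "\<sigma> p \<in> I" if "\<sigma> permutes I" "p \<in> I" for \<sigma> p
    using that by (simp add: permutes_in_image)
  have mc: "?m \<sigma> k \<in> carrier R" if "\<sigma> permutes I" for \<sigma> k
    using a in_I[OF that] by (intro add_pow_sign_closed finprod_closed) auto
  have ac: "a p i \<in> carrier R" "y p \<in> carrier R" if "p \<in> I" "i \<in> I" for p i
    using a y that by auto
  let ?g = "\<lambda>\<sigma> i. [sign \<sigma>] \<cdot> (\<Otimes>p\<in>I. ?N i p (\<sigma> p)) \<otimes> a q i"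
  have gc: "?g \<sigma> i \<in> carrier R" if "\<sigma> permutes I" "i \<in> I" for \<sigma> i
    using perm_det_term_closed[OF N that(1)] ac[OF q that(2)] by auto
  \<comment> \<open>As \<sigma> is injective, its product meets the replaced column
    \<open>\<sigma> k\<close> only in row \<open>k\<close>. That row contributes \<open>y k\<close>,
    and all other factors are entries of \<open>a\<close>.\<close>
  have g: "?g \<sigma> (\<sigma> k) = y k \<otimes> (a q (\<sigma> k) \<otimes> ?m \<sigma> k)" if s: "\<sigma> permutes I" and k: "k \<in> I" for \<sigma> k
  proof -
    have "(\<Otimes>p\<in>I - {k}. ?N (\<sigma> k) p (\<sigma> p)) = (\<Otimes>p\<in>I - {k}. a p (\<sigma> p))"
      using a in_I[OF s] injD[OF permutes_inj[OF s]] by (intro finprod_cong') auto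
    then have "?g \<sigma> (\<sigma> k) = y k \<otimes> ?m \<sigma> k \<otimes> a q (\<sigma> k)"
      using perm_det_term_split[OF I k s N, of "\<sigma> k"] by simp
    then show ?thesis using mc[OF s] ac q k in_I[OF s] by (simp add: m_ac)
  qed
  have "(\<Oplus>i\<in>I. perm_det R I (?N i) \<otimes> a q i) = (\<Oplus>i\<in>I. \<Oplus>\<sigma>\<in>?S. ?g \<sigma> i)"
  proof (rule finsum_cong'[OF refl])
    show "(\<lambda>i. \<Oplus>\<sigma>\<in>?S. ?g \<sigma> i) \<in> I \<rightarrow> carrier R" using gc by (auto intro!: finsum_closed)
    fix i assume i: "i \<in> I"
    show "perm_det R I (?N i) \<otimes> a q i = (\<Oplus>\<sigma>\<in>?S. ?g \<sigma> i)"
      unfolding perm_det_def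
      by (rule finsum_ldistr) (use fS ac q i perm_det_term_closed[OF N] in auto)
  qed
  also have "\<dots> = (\<Oplus>\<sigma>\<in>?S. \<Oplus>i\<in>I. ?g \<sigma> i)"
    using gc by (intro finsum_swap[OF I fS]) auto
  also have "\<dots> = (\<Oplus>\<sigma>\<in>?S. \<Oplus>k\<in>I. y k \<otimes> (a q (\<sigma> k) \<otimes> ?m \<sigma> k))"
  proof (rule finsum_cong'[OF refl])
    show "(\<lambda>\<sigma>. \<Oplus>k\<in>I. y k \<otimes> (a q (\<sigma> k) \<otimes> ?m \<sigma> k)) \<in> ?S \<rightarrow> carrier R"
      using mc ac q in_I by (auto intro!: finsum_closed)
    fix \<sigma> assume "\<sigma> \<in> ?S"
    then have s: "\<sigma> permutes I" by simp
    \<comment> \<open>Since \<sigma> is a bijection of \<open>I\<close>, each column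
      \<open>i\<close> can be written as \<open>\<sigma> k\<close>, where \<open>k\<close> is the
      row from which \<sigma> selects that column.\<close>
    have "(\<Oplus>i\<in>I. ?g \<sigma> i) = (\<Oplus>i\<in>\<sigma> ` I. ?g \<sigma> i)" using s by (simp add: permutes_image)
    also have "\<dots> = (\<Oplus>k\<in>I. ?g \<sigma> (\<sigma> k))"
      using gc s by (intro finsum_reindex) (auto simp: permutes_image permutes_inj_on)
    also have "\<dots> = (\<Oplus>k\<in>I. y k \<otimes> (a q (\<sigma> k) \<otimes> ?m \<sigma> k))"
      using mc[OF s] ac q in_I[OF s] by (intro finsum_cong' g[OF s]) auto
    finally show "(\<Oplus>i\<in>I. ?g \<sigma> i) = (\<Oplus>k\<in>I. y k \<otimes> (a q (\<sigma> k) \<otimes> ?m \<sigma> k))" .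
  qed
  also have "\<dots> = (\<Oplus>k\<in>I. \<Oplus>\<sigma>\<in>?S. y k \<otimes> (a q (\<sigma> k) \<otimes> ?m \<sigma> k))"
    using mc ac q in_I by (intro finsum_swap[OF fS I]) auto
  also have "\<dots> = (\<Oplus>k\<in>I. y k \<otimes> perm_det R I (a(k := a q)))"
  proof (rule finsum_cong'[OF refl])
    show "(\<lambda>k. y k \<otimes> perm_det R I (a(k := a q))) \<in> I \<rightarrow> carrier R"
      using a q y by (auto simp: Pi_iff intro!: m_closed perm_det_closed)
    fix k assume k: "k \<in> I"
    have aq: "a q \<in> I \<rightarrow> carrier R" using a q by auto
    show "(\<Oplus>\<sigma>\<in>?S. y k \<otimes> (a q (\<sigma> k) \<otimes> ?m \<sigma> k)) = y k \<otimes> perm_det R I (a(k := a q))"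
      unfolding perm_det_replace_row[OF I k a aq]
      by (rule finsum_rdistr[symmetric]) (use fS mc ac q k in_I in auto)
  qed
  also have "\<dots> = (\<Oplus>k\<in>I. y k \<otimes> (if k = q then perm_det R I a else \<zero>))"
    using perm_det_closed[OF a] y
    by (intro finsum_cong') (auto simp: perm_det_replace_row_by_row[OF I a _ q])
  also have "\<dots> = perm_det R I a \<otimes> y q"
    using finsum_delta[OF I q, of "\<lambda>k. y k \<otimes> (if k = q then perm_det R I a else \<zero>)"]
      perm_det_closed[OF a] y q by (auto simp: m_comm Pi_iff)
  finally show ?thesis .
qed

text \<open>In the transpose \<open>b\<close>, replace row \<open>i\<close> by the sum of the rows
  \<open>j\<close> weighted by \<open>c j\<close>. The terms with \<open>j\<close> different from
  \<open>i\<close> have a repeated row, so the determinant becomes \<open>c i\<close> times the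
  original one; yet the new row is zero by the assumed relations.\<close>

lemma perm_det_kernel:
  assumes I: "finite I" and a: "a \<in> I \<rightarrow> I \<rightarrow> carrier R" and c: "c \<in> I \<rightarrow> carrier R"
    and zero: "\<And>p. p \<in> I \<Longrightarrow> (\<Oplus>i\<in>I. c i \<otimes> a p i) = \<zero>" and i: "i \<in> I"
  shows "perm_det R I a \<otimes> c i = \<zero>"
proof -
  let ?S = "{\<sigma>. \<sigma> permutes I}"
  define b where "b = (\<lambda>i p. a p i)"
  let ?m = "\<lambda>\<sigma>. [sign \<sigma>] \<cdot> (\<Otimes>p\<in>I - {i}. b p (\<sigma> p))"
  have fS: "finite ?S" using finite_permutations[OF I] .
  have b: "b \<in> I \<rightarrow> I \<rightarrow> carrier R" using a by (auto simp: b_def)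
  have in_I: "\<sigma> p \<in> I" if "\<sigma> permutes I" "p \<in> I" for \<sigma> p
    using that by (simp add: permutes_in_image)
  have mc: "?m \<sigma> \<in> carrier R" if "\<sigma> permutes I" for \<sigma>
    using b in_I[OF that] by (intro add_pow_sign_closed finprod_closed) auto
  have bc: "b p i \<in> carrier R" "c p \<in> carrier R" if "p \<in> I" "i \<in> I" for p i
    using b c that by auto
  have "perm_det R I a \<otimes> c i = (\<Oplus>j\<in>I. c j \<otimes> (if i = j then perm_det R I b else \<zero>))"
    using finsum_delta[OF I i, of "\<lambda>j. c j \<otimes> (if i = j then perm_det R I b else \<zero>)"]
      perm_det_closed[OF b] perm_det_transpose[OF I a] c i by (auto simp: m_comm Pi_iff b_def)
  also have "\<dots> = (\<Oplus>j\<in>I. c j \<otimes> perm_det R I (b(i := b j)))"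
    using perm_det_closed[OF b] c
    by (intro finsum_cong') (auto simp: perm_det_replace_row_by_row[OF I b i])
  also have "\<dots> = (\<Oplus>j\<in>I. \<Oplus>\<sigma>\<in>?S. c j \<otimes> b j (\<sigma> i) \<otimes> ?m \<sigma>)"
  proof (rule finsum_cong'[OF refl])
    show "(\<lambda>j. \<Oplus>\<sigma>\<in>?S. c j \<otimes> b j (\<sigma> i) \<otimes> ?m \<sigma>) \<in> I \<rightarrow> carrier R"
      using mc bc in_I i by (auto intro!: finsum_closed)
    fix j assume j: "j \<in> I"
    have bj: "b j \<in> I \<rightarrow> carrier R" using b j by auto
    have "c j \<otimes> perm_det R I (b(i := b j)) = (\<Oplus>\<sigma>\<in>?S. c j \<otimes> (b j (\<sigma> i) \<otimes> ?m \<sigma>))"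
      unfolding perm_det_replace_row[OF I i b bj]
      by (rule finsum_rdistr) (use fS mc bc i j in_I in auto)
    also have "\<dots> = (\<Oplus>\<sigma>\<in>?S. c j \<otimes> b j (\<sigma> i) \<otimes> ?m \<sigma>)"
      using mc bc i j in_I by (intro finsum_cong') (auto simp: m_assoc)
    finally show "c j \<otimes> perm_det R I (b(i := b j)) = (\<Oplus>\<sigma>\<in>?S. c j \<otimes> b j (\<sigma> i) \<otimes> ?m \<sigma>)" .
  qed
  also have "\<dots> = (\<Oplus>\<sigma>\<in>?S. \<Oplus>j\<in>I. c j \<otimes> b j (\<sigma> i) \<otimes> ?m \<sigma>)"
    using mc bc in_I i by (intro finsum_swap[OF I fS]) auto
  \<comment> \<open>With \<sigma> fixed, the sum over \<open>j\<close> is the assumed relation for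
    row \<open>\<sigma> i\<close> of \<open>a\<close>, times a common factor.\<close>
  also have "\<dots> = (\<Oplus>\<sigma>\<in>?S. \<zero>)"
  proof (rule finsum_cong'[OF refl])
    fix \<sigma> assume "\<sigma> \<in> ?S"
    then have s: "\<sigma> permutes I" by simp
    have "(\<Oplus>j\<in>I. c j \<otimes> b j (\<sigma> i) \<otimes> ?m \<sigma>) = (\<Oplus>j\<in>I. c j \<otimes> b j (\<sigma> i)) \<otimes> ?m \<sigma>"
      by (rule finsum_ldistr[symmetric]) (use I mc[OF s] bc in_I[OF s] i in auto)
    then show "(\<Oplus>j\<in>I. c j \<otimes> b j (\<sigma> i) \<otimes> ?m \<sigma>) = \<zero>"
      using zero[OF in_I[OF s i]] mc[OF s] by (simp add: b_def)
  qed simp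
  finally show ?thesis by simp
qed

end

lemma (in ring_hom_cring) hom_perm_det:
  assumes "a \<in> I \<rightarrow> I \<rightarrow> carrier R"
  shows "h (perm_det R I a) = perm_det S I (\<lambda>p i. h (a p i))"
proof -
  have sgn: "h ([sign \<sigma>] \<cdot>\<^bsub>R\<^esub> X) = [sign \<sigma>] \<cdot>\<^bsub>S\<^esub> h X" if "X \<in> carrier R" for X \<sigma>
    using that by (cases \<sigma> rule: sign_cases) (auto simp: R.add.int_pow_neg S.add.int_pow_neg)
  have pc: "(\<lambda>p. a p (\<sigma> p)) \<in> I \<rightarrow> carrier R" if "\<sigma> permutes I" for \<sigma>
    using assms permutes_in_image[OF that] by auto
  have "h (perm_det R I a) =
      (\<Oplus>\<^bsub>S\<^esub>\<sigma>\<in>{\<sigma>. \<sigma> permutes I}. h ([sign \<sigma>] \<cdot>\<^bsub>R\<^esub> (\<Otimes>\<^bsub>R\<^esub>p\<in>I. a p (\<sigma> p))))"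
    unfolding perm_det_def
    by (subst hom_finsum) (use R.perm_det_term_closed[OF assms] in \<open>auto simp: comp_def\<close>)
  also have "\<dots> = perm_det S I (\<lambda>p i. h (a p i))"
    unfolding perm_det_def
  proof (rule S.finsum_cong'[OF refl])
    show "(\<lambda>\<sigma>. [sign \<sigma>] \<cdot>\<^bsub>S\<^esub> (\<Otimes>\<^bsub>S\<^esub>p\<in>I. h (a p (\<sigma> p)))) \<in> {\<sigma>. \<sigma> permutes I} \<rightarrow> carrier S"
      using pc by (auto intro!: S.add_pow_sign_closed S.finprod_closed)
    fix \<sigma> assume "\<sigma> \<in> {\<sigma>. \<sigma> permutes I}"
    then have s: "\<sigma> permutes I" by simp
    show "h ([sign \<sigma>] \<cdot>\<^bsub>R\<^esub> (\<Otimes>\<^bsub>R\<^esub>p\<in>I. a p (\<sigma> p))) = [sign \<sigma>] \<cdot>\<^bsub>S\<^esub> (\<Otimes>\<^bsub>S\<^esub>p\<in>I. h (a p (\<sigma> p)))"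
      using R.finprod_closed[OF pc[OF s]] hom_finprod[OF pc[OF s]] by (simp add: sgn comp_def)
  qed
  finally show ?thesis .
qed

section \<open>Bases of localizations\<close>

context cring begin

section \<open>Fractions over a common denominator\<close>

lemma fraction_closed: "r \<in> carrier R \<Longrightarrow> fraction R s r k \<in> carrier (localization R s)"
  unfolding localization_simps by blast

text \<open>The general addition rule doubles the exponent; a factor \<open>s [^] k\<close> cancels
  from numerator and denominator.\<close>

lemma fraction_add_same:
  assumes "s \<in> carrier R" "r \<in> carrier R" "r' \<in> carrier R"
  shows "fraction R s r k \<oplus>\<^bsub>localization R s\<^esub> fraction R s r' k = fraction R s (r \<oplus> r') k"
  unfolding fraction_add[OF assms] using assms
  by (subst fraction_eq_iff) (auto simp: nat_pow_add r_distr m_ac)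

lemma fraction_zero_iff:
  assumes "s \<in> carrier R" "r \<in> carrier R"
  shows "fraction R s r k = \<zero>\<^bsub>localization R s\<^esub> \<longleftrightarrow> (\<exists>m::nat. s [^] m \<otimes> r = \<zero>)"
  unfolding localization_simps using assms by (subst fraction_eq_iff) auto

lemma fraction_cancel:
  assumes "s \<in> carrier R" "r \<in> carrier R"
  shows "fraction R s (s [^] (j::nat) \<otimes> r) (j + k) = fraction R s r k"
  unfolding fraction_eq_iff[OF assms(1) m_closed[OF nat_pow_closed[OF assms(1)] assms(2)] assms(2)]
  using assms by (intro exI[of _ 0]) (simp add: nat_pow_add m_ac)

lemma finsum_fraction:
  assumes s: "s \<in> carrier R" and "finite I" "b \<in> I \<rightarrow> carrier R"
  shows "(\<Oplus>\<^bsub>localization R s\<^esub>i\<in>I. fraction R s (b i) k) = fraction R s (\<Oplus>i\<in>I. b i) k"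
proof -
  interpret L: cring "localization R s" by (rule localization_cring[OF s])
  show ?thesis using assms(2,3)
  proof (induction I rule: finite_induct)
    case empty
    have "fraction R s \<zero> k = \<zero>\<^bsub>localization R s\<^esub>"
      unfolding fraction_zero_iff[OF s zero_closed] using s by auto
    then show ?case by simp
  next
    case (insert j I)
    then have "(\<Oplus>\<^bsub>localization R s\<^esub>i\<in>insert j I. fraction R s (b i) k) =
        fraction R s (b j) k \<oplus>\<^bsub>localization R s\<^esub> fraction R s (\<Oplus>i\<in>I. b i) k"
      by (subst L.finsum_insert) (auto intro!: fraction_closed)
    then show ?case using insert s by (simp add: fraction_add_same Pi_iff)
  qed
qed

lemma common_denominator:
  assumes s: "s \<in> carrier R" and I: "finite I" and c: "c \<in> I \<rightarrow> carrier (localization R s)"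
  obtains a k where "a \<in> I \<rightarrow> carrier R" "\<And>i. i \<in> I \<Longrightarrow> c i = fraction R s (a i) k"
proof -
  have "\<forall>i\<in>I. \<exists>r k. r \<in> carrier R \<and> c i = fraction R s r k"
    using c unfolding localization_simps by blast
  then obtain r d where r: "\<And>i. i \<in> I \<Longrightarrow> r i \<in> carrier R" and d: "\<And>i. i \<in> I \<Longrightarrow> c i = fraction R s (r i) (d i)"
    by metis
  \<comment> \<open>The sum bounds every exponent and, unlike a maximum, is also defined for empty
    \<open>I\<close>.\<close>
  let ?k = "\<Sum>i\<in>I. d i"
  have le: "d i \<le> ?k" if "i \<in> I" for i using I that by (simp add: member_le_sum)
  show thesis
  proof (rule that[of "\<lambda>i. s [^] (?k - d i) \<otimes> r i" ?k])
    show "(\<lambda>i. s [^] (?k - d i) \<otimes> r i) \<in> I \<rightarrow> carrier R" using s r by auto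
    fix i assume i: "i \<in> I"
    show "c i = fraction R s (s [^] (?k - d i) \<otimes> r i) ?k"
      using fraction_cancel[OF s r[OF i], of "?k - d i" "d i"] le[OF i] d[OF i] by simp
  qed
qed

end

text \<open>A finite sum depends only on carrier, zero and addition, which
  \<open>module_via_hom\<close> copies from the ring.\<close>

lemma finsum_module_via_hom: "finsum (module_via_hom h C) f I = finsum C f I"
  by (simp add: finsum_def finprod_def module_via_hom_def)

text \<open>Reduces the basis property to two statements without denominators. Inverting
  \<open>s\<close> turns coefficients killed by \<open>s\<close> into zero coefficients, and turns a
  combination equal to \<open>s\<close> times an element into one equal to the element
  itself.\<close>

theorem module_basis_localization:
  assumes C: "cring C" and BC: "subcring B C" and s: "s \<in> B"
    and I: "finite I" and b: "b \<in> I \<rightarrow> carrier C"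
    and indep: "\<And>a i. a \<in> I \<rightarrow> B \<Longrightarrow> (\<Oplus>\<^bsub>C\<^esub>i\<in>I. a i \<otimes>\<^bsub>C\<^esub> b i) = \<zero>\<^bsub>C\<^esub> \<Longrightarrow> i \<in> I \<Longrightarrow> s \<otimes>\<^bsub>C\<^esub> a i = \<zero>\<^bsub>C\<^esub>"
    and span: "\<And>y. y \<in> carrier C \<Longrightarrow> \<exists>a \<in> I \<rightarrow> B. s \<otimes>\<^bsub>C\<^esub> y = (\<Oplus>\<^bsub>C\<^esub>i\<in>I. a i \<otimes>\<^bsub>C\<^esub> b i)"
  shows "module_basis (localization (C\<lparr>carrier := B\<rparr>) s)
    (module_via_hom (localization_map C s) (localization C s)) I (\<lambda>i. fraction C s (b i) 0)"
proof -
  interpret C: cring C by fact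
  let ?B = "C\<lparr>carrier := B\<rparr>"
  have sub: "B \<subseteq> carrier C" using BC subcringE(1) by blast
  interpret B: cring ?B using C.subcring_iff[OF sub] BC by blast
  have sC: "s \<in> carrier C" and sB: "s \<in> carrier ?B" using s sub by auto
  have pow: "s [^]\<^bsub>?B\<^esub> (k::nat) = s [^]\<^bsub>C\<^esub> k" for k by (simp add: nat_pow_def)
  have powB: "s [^]\<^bsub>C\<^esub> (k::nat) \<in> B" for k
    using B.nat_pow_closed[OF sB, of k] unfolding pow by simp
  have mB: "u \<otimes>\<^bsub>C\<^esub> v \<in> B" if "u \<in> B" "v \<in> B" for u v
    using B.m_closed[of u v] that by simp
  interpret L: cring "localization C s" by (rule C.localization_cring[OF sC])
  let ?h = "localization_map C s"
  let ?M = "module_via_hom ?h (localization C s)"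
  have M: "module (localization ?B s) ?M"
    using module_via_hom_algebra[OF B.localization_cring[OF sB] L.is_cring localization_map_hom(1)[OF C BC s]]
    by (simp add: algebra_def)
  have smult: "fraction ?B s r k \<odot>\<^bsub>?M\<^esub> fraction C s t l = fraction C s (r \<otimes>\<^bsub>C\<^esub> t) (k + l)"
    if "r \<in> B" "t \<in> carrier C" for r t k l
    using that sub sC C.fraction_mult[of s r t k l] localization_map_fraction[OF C BC s that(1)]
    by (auto simp: module_via_hom_def)
  \<comment> \<open>With one denominator for all coefficients, a combination of fractions is a
    single fraction, so both halves of the basis property can be read off numerators in
    \<open>C\<close>.\<close>
  have lincomb: "(\<Oplus>\<^bsub>?M\<^esub>i\<in>I. fraction ?B s (a i) k \<odot>\<^bsub>?M\<^esub> fraction C s (b i) 0) =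
      fraction C s (\<Oplus>\<^bsub>C\<^esub>i\<in>I. a i \<otimes>\<^bsub>C\<^esub> b i) k" if a: "a \<in> I \<rightarrow> B" for a k
  proof -
    have ab: "a i \<otimes>\<^bsub>C\<^esub> b i \<in> carrier C" if "i \<in> I" for i using that a b sub by auto
    have "(\<Oplus>\<^bsub>?M\<^esub>i\<in>I. fraction ?B s (a i) k \<odot>\<^bsub>?M\<^esub> fraction C s (b i) 0) =
        (\<Oplus>\<^bsub>localization C s\<^esub>i\<in>I. fraction C s (a i \<otimes>\<^bsub>C\<^esub> b i) k)"
      unfolding finsum_module_via_hom
    proof (rule L.finsum_cong'[OF refl])
      fix i assume "i \<in> I"
      then show "fraction ?B s (a i) k \<odot>\<^bsub>?M\<^esub> fraction C s (b i) 0 = fraction C s (a i \<otimes>\<^bsub>C\<^esub> b i) k"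
        using smult[of "a i" "b i" k 0] a b by auto
    qed (use ab in \<open>auto intro: C.fraction_closed\<close>)
    then show ?thesis using C.finsum_fraction[OF sC I, of "\<lambda>i. a i \<otimes>\<^bsub>C\<^esub> b i"] ab by simp
  qed
  have lincomb': "(\<Oplus>\<^bsub>?M\<^esub>i\<in>I. c i \<odot>\<^bsub>?M\<^esub> fraction C s (b i) 0) =
      fraction C s (\<Oplus>\<^bsub>C\<^esub>i\<in>I. a i \<otimes>\<^bsub>C\<^esub> b i) k"
    if a: "a \<in> I \<rightarrow> B" and c: "\<And>i. i \<in> I \<Longrightarrow> c i = fraction ?B s (a i) k" for a c k
  proof -
    have "fraction ?B s (a i) k \<odot>\<^bsub>?M\<^esub> fraction C s (b i) 0 \<in> carrier (localization C s)" if "i \<in> I" for i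
      using smult[of "a i" "b i" k 0] a b sub that by (auto simp: Pi_iff subset_iff intro!: C.fraction_closed)
    then have "(\<Oplus>\<^bsub>?M\<^esub>i\<in>I. c i \<odot>\<^bsub>?M\<^esub> fraction C s (b i) 0) =
        (\<Oplus>\<^bsub>?M\<^esub>i\<in>I. fraction ?B s (a i) k \<odot>\<^bsub>?M\<^esub> fraction C s (b i) 0)"
      unfolding finsum_module_via_hom using c by (intro L.finsum_cong') auto
    then show ?thesis using lincomb[OF a] by simp
  qed
  show ?thesis
    unfolding module_basis_def
  proof (intro conjI ballI impI)
    show "module (localization ?B s) ?M" by (rule M)
    show "(\<lambda>i. fraction C s (b i) 0) \<in> I \<rightarrow> carrier ?M"
      using b by (auto simp: module_via_hom_def intro!: C.fraction_closed)
  next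
    fix c i
    assume c: "c \<in> I \<rightarrow> carrier (localization ?B s)"
      and z: "(\<Oplus>\<^bsub>?M\<^esub>i\<in>I. c i \<odot>\<^bsub>?M\<^esub> fraction C s (b i) 0) = \<zero>\<^bsub>?M\<^esub>" and i: "i \<in> I"
    obtain a k where a: "a \<in> I \<rightarrow> carrier ?B" and ca: "\<And>i. i \<in> I \<Longrightarrow> c i = fraction ?B s (a i) k"
      using B.common_denominator[OF sB I c] by blast
    have aB: "a \<in> I \<rightarrow> B" using a by simp
    have ab: "(\<lambda>i. a i \<otimes>\<^bsub>C\<^esub> b i) \<in> I \<rightarrow> carrier C" using aB b sub by auto
    have "fraction C s (\<Oplus>\<^bsub>C\<^esub>i\<in>I. a i \<otimes>\<^bsub>C\<^esub> b i) k = \<zero>\<^bsub>localization C s\<^esub>"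
      using z lincomb'[OF aB ca] by (simp add: module_via_hom_def)
    then obtain m :: nat where m: "s [^]\<^bsub>C\<^esub> m \<otimes>\<^bsub>C\<^esub> (\<Oplus>\<^bsub>C\<^esub>i\<in>I. a i \<otimes>\<^bsub>C\<^esub> b i) = \<zero>\<^bsub>C\<^esub>"
      using C.fraction_zero_iff[OF sC C.finsum_closed[OF ab]] by blast
    \<comment> \<open>The power of \<open>s\<close> that kills the numerator is moved into the
      coefficients; they remain in \<open>B\<close>, so \<open>indep\<close> applies to
      them.\<close>
    have "(\<Oplus>\<^bsub>C\<^esub>i\<in>I. (s [^]\<^bsub>C\<^esub> m \<otimes>\<^bsub>C\<^esub> a i) \<otimes>\<^bsub>C\<^esub> b i) = (\<Oplus>\<^bsub>C\<^esub>i\<in>I. s [^]\<^bsub>C\<^esub> m \<otimes>\<^bsub>C\<^esub> (a i \<otimes>\<^bsub>C\<^esub> b i))"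
      using aB b sub sC by (intro C.finsum_cong') (auto simp: Pi_iff subset_iff C.m_assoc)
    also have "\<dots> = \<zero>\<^bsub>C\<^esub>"
      unfolding m[symmetric] using C.finsum_rdistr[OF I _ ab] sC by simp
    finally have "s \<otimes>\<^bsub>C\<^esub> (s [^]\<^bsub>C\<^esub> m \<otimes>\<^bsub>C\<^esub> a i) = \<zero>\<^bsub>C\<^esub>"
      using indep[of "\<lambda>i. s [^]\<^bsub>C\<^esub> m \<otimes>\<^bsub>C\<^esub> a i"] aB powB mB i by (auto simp: Pi_iff)
    moreover have ai: "a i \<in> B" "a i \<in> carrier C" using aB i sub by auto
    \<comment> \<open>The factor \<open>s\<close> coming from \<open>indep\<close> raises the
      exponent by one. A fraction is zero as soon as some power of \<open>s\<close> kills its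
      numerator.\<close>
    ultimately have "s [^]\<^bsub>C\<^esub> (Suc m) \<otimes>\<^bsub>C\<^esub> a i = \<zero>\<^bsub>C\<^esub>"
      using sC by (simp add: C.m_ac)
    then have "\<exists>m::nat. s [^]\<^bsub>?B\<^esub> m \<otimes>\<^bsub>?B\<^esub> a i = \<zero>\<^bsub>?B\<^esub>" unfolding pow
      by (intro exI[of _ "Suc m"]) simp
    then show "c i = \<zero>\<^bsub>localization ?B s\<^esub>"
      unfolding ca[OF i] using B.fraction_zero_iff[OF sB, of "a i"] ai by simp
  next
    fix Y assume "Y \<in> carrier ?M"
    then obtain y k where y: "y \<in> carrier C" "Y = fraction C s y k"
      unfolding module_via_hom_def by (auto simp: C.localization_simps)
    obtain a where a: "a \<in> I \<rightarrow> B" "s \<otimes>\<^bsub>C\<^esub> y = (\<Oplus>\<^bsub>C\<^esub>i\<in>I. a i \<otimes>\<^bsub>C\<^esub> b i)"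
      using span[OF y(1)] by blast
    \<comment> \<open>Numerator and denominator are both multiplied by \<open>s\<close>, because
      \<open>span\<close> only expresses \<open>s\<close> times \<open>y\<close>.\<close>
    have "Y = fraction C s (s \<otimes>\<^bsub>C\<^esub> y) (Suc k)"
      using C.fraction_cancel[OF sC y(1), of 1 k] y(2) sC by simp
    then have "Y = (\<Oplus>\<^bsub>?M\<^esub>i\<in>I. fraction ?B s (a i) (Suc k) \<odot>\<^bsub>?M\<^esub> fraction C s (b i) 0)"
      using lincomb[OF a(1)] a(2) by simp
    moreover have "(\<lambda>i. fraction ?B s (a i) (Suc k)) \<in> I \<rightarrow> carrier (localization ?B s)"
      using a(1) by (auto intro!: B.fraction_closed)
    ultimately show "\<exists>c\<in>I \<rightarrow> carrier (localization ?B s). Y = (\<Oplus>\<^bsub>?M\<^esub>i\<in>I. c i \<odot>\<^bsub>?M\<^esub> fraction C s (b i) 0)"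
      by (intro bexI[of _ "\<lambda>i. fraction ?B s (a i) (Suc k)"])
  qed
qed

section \<open>The alternating tensor as a determinant\<close>

context algebra begin

section \<open>Coprojections as the entries of a matrix\<close>

lemma coprojection_closed: "r \<in> carrier M \<Longrightarrow> coprojection R M n p r \<in> carrier (tensor_power R M n)"
  unfolding coprojection_def by (intro pure_tensor_closed) auto

lemma pure_tensor_mult:
  assumes "u \<in> {1..n} \<rightarrow> carrier M" "v \<in> {1..n} \<rightarrow> carrier M"
  shows "pure_tensor R M n u \<otimes>\<^bsub>tensor_power R M n\<^esub> pure_tensor R M n v =
    pure_tensor R M n (\<lambda>p. u p \<otimes>\<^bsub>M\<^esub> v p)"
proof -
  have "frag_of (restrict u {1..n}) \<in> carrier (tuple_ring M n)" "frag_of (restrict v {1..n}) \<in> carrier (tuple_ring M n)"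
    using assms by (auto simp: tuple_ring_simps)
  from ring_hom_mult[OF tensor_coset_hom this, symmetric]
  show ?thesis unfolding pure_tensor_def tuple_mult_of
    by (simp cong: restrict_cong)
qed

lemma finprod_coprojection:
  assumes u: "u \<in> {1..n} \<rightarrow> carrier M"
  shows "(\<Otimes>\<^bsub>tensor_power R M n\<^esub>p\<in>{1..n}. coprojection R M n p (u p)) = pure_tensor R M n u"
proof -
  interpret T: cring "tensor_power R M n" by (rule tensor_power_cring)
  \<comment> \<open>Generalised to a set \<open>S\<close> of slots for the induction, with the unit
    in every other slot.\<close>
  have "(\<Otimes>\<^bsub>tensor_power R M n\<^esub>p\<in>S. coprojection R M n p (u p)) =
      pure_tensor R M n (\<lambda>i. if i \<in> S then u i else \<one>\<^bsub>M\<^esub>)" if "finite S" "S \<subseteq> {1..n}" for S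
    using that
  proof (induction S rule: finite_induct)
    case empty
    show ?case using ring_hom_one[OF tensor_coset_hom[of n]] by (simp add: pure_tensor_def tuple_ring_simps)
  next
    case (insert q S)
    let ?e = "\<lambda>i. if i = q then u q else \<one>\<^bsub>M\<^esub>" and ?f = "\<lambda>i. if i \<in> S then u i else \<one>\<^bsub>M\<^esub>"
    have "(\<Otimes>\<^bsub>tensor_power R M n\<^esub>p\<in>insert q S. coprojection R M n p (u p)) =
        pure_tensor R M n ?e \<otimes>\<^bsub>tensor_power R M n\<^esub> pure_tensor R M n ?f"
      using insert u coprojection_closed
      by (subst T.finprod_insert) (auto simp: coprojection_def Pi_iff subset_iff)
    also have "\<dots> = pure_tensor R M n (\<lambda>p. ?e p \<otimes>\<^bsub>M\<^esub> ?f p)"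
      using insert u by (intro pure_tensor_mult) auto
    also have "\<dots> = pure_tensor R M n (\<lambda>i. if i \<in> insert q S then u i else \<one>\<^bsub>M\<^esub>)"
      unfolding pure_tensor_def using insert u
      by (intro arg_cong[of _ _ "\<lambda>v. tensor_ideal R M n +>\<^bsub>tuple_ring M n\<^esub> frag_of v"] restrict_ext)
        (auto simp: Pi_iff subset_iff)
    finally show ?case .
  qed
  from this[of "{1..n}"] show ?thesis
    unfolding pure_tensor_def by (simp cong: restrict_cong)
qed

text \<open>The pure tensor of \<open>x \<circ> \<sigma>\<close> is the product of the entries that
  \<sigma> selects. Rows are tensor factors and columns are the given elements, so permuting factors
  permutes rows.\<close>

lemma alternating_tensor_eq_det:
  assumes x: "x \<in> {1..n} \<rightarrow> carrier M"
  shows "alternating_tensor R M n x =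
    perm_det (tensor_power R M n) {1..n} (\<lambda>p i. coprojection R M n p (x i))"
proof -
  interpret T: cring "tensor_power R M n" by (rule tensor_power_cring)
  have xs: "x \<circ> \<sigma> \<in> {1..n} \<rightarrow> carrier M" if "\<sigma> permutes {1..n}" for \<sigma>
    using x permutes_in_image[OF that] by (auto simp: Pi_iff)
  show ?thesis
    unfolding alternating_tensor_def perm_det_def
  proof (rule T.finsum_cong'[OF refl])
    show "(\<lambda>\<sigma>. [sign \<sigma>] \<cdot>\<^bsub>tensor_power R M n\<^esub> (\<Otimes>\<^bsub>tensor_power R M n\<^esub>p\<in>{1..n}. coprojection R M n p (x (\<sigma> p))))
        \<in> {\<sigma>. \<sigma> permutes {1..n}} \<rightarrow> carrier (tensor_power R M n)"
      using x by (auto intro!: T.perm_det_term_closed coprojection_closed)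
    fix \<sigma> assume "\<sigma> \<in> {\<sigma>. \<sigma> permutes {1..n}}"
    then show "[sign \<sigma>] \<cdot>\<^bsub>tensor_power R M n\<^esub> pure_tensor R M n (x \<circ> \<sigma>) =
        [sign \<sigma>] \<cdot>\<^bsub>tensor_power R M n\<^esub> (\<Otimes>\<^bsub>tensor_power R M n\<^esub>p\<in>{1..n}. coprojection R M n p (x (\<sigma> p)))"
      using finprod_coprojection[OF xs] by simp
  qed
qed

section \<open>The action of the symmetric group on entries and determinants\<close>

lemma permute_factors_coprojection:
  assumes "\<sigma> permutes {1..n}"
  shows "permute_factors \<sigma> (coprojection R M n p r) = coprojection R M n (inv_into UNIV \<sigma> p) r"
proof -
  \<comment> \<open>Permutations act by precomposition, so the entry in slot \<open>p\<close> moves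
    to the slot that \<sigma> sends to \<open>p\<close>; this is where the inverse comes
    from.\<close>
  have "(\<lambda>i. if i = p then r else \<one>\<^bsub>M\<^esub>) \<circ> \<sigma> = (\<lambda>i. if i = inv_into UNIV \<sigma> p then r else \<one>\<^bsub>M\<^esub>)"
    using permutes_inverses[OF assms] by (auto simp: fun_eq_iff)
  then show ?thesis unfolding coprojection_def permute_factors_pure_tensor[OF assms] by simp
qed

text \<open>Precomposition reverses the order of composition: this is a right action.\<close>

lemma permute_factors_comp: "permute_factors \<sigma> (permute_factors \<tau> X) = permute_factors (\<tau> \<circ> \<sigma>) X"
  by (simp add: permute_factors_def image_image permute_frag_comp)

text \<open>The conjugates of \<open>y\<close> are indexed by the factor exchanged with the last
  one. They transform like the coprojections, because the two permutations applied to
  \<open>y\<close> differ only by one that fixes \<open>n\<close>, under which \<open>y\<close> is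
  invariant.\<close>

lemma permute_factors_conjugate:
  assumes n: "n \<ge> 1" and y: "y \<in> carrier (TS_last R M n)" and s: "\<sigma> permutes {1..n}" and p: "p \<in> {1..n}"
  shows "permute_factors \<sigma> (permute_factors (transpose p n) y) =
    permute_factors (transpose (inv_into UNIV \<sigma> p) n) y"
proof -
  let ?q = "inv_into UNIV \<sigma> p"
  let ?\<kappa> = "transpose p n \<circ> \<sigma> \<circ> transpose ?q n"
  have q: "?q \<in> {1..n}" using permutes_in_image[OF permutes_inv[OF s]] p by blast
  have k: "?\<kappa> permutes {1..n}"
    using p q n s by (intro permutes_compose permutes_swap_id) auto
  \<comment> \<open>The three maps send \<open>n\<close> to \<open>?q\<close>, then to
    \<open>p\<close>, then back to \<open>n\<close>.\<close>
  have "?\<kappa> n = n" using permutes_inverses[OF s] by simp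
  then have "?\<kappa> permutes {1..n - 1}"
  proof (intro permutes_superset[OF k])
    fix i assume "i \<in> {1..n} - {1..n - 1}"
    then have "i = n" by auto
    then show "?\<kappa> i = i" using \<open>?\<kappa> n = n\<close> by simp
  qed
  then have "permute_factors ?\<kappa> y = y" using y by (simp add: TS_last_def tensor_invariants_def)
  moreover have "transpose p n \<circ> \<sigma> = ?\<kappa> \<circ> transpose ?q n" by (simp add: comp_assoc)
  then have "permute_factors (transpose p n \<circ> \<sigma>) y =
      permute_factors (transpose ?q n) (permute_factors ?\<kappa> y)"
    by (simp only: permute_factors_comp)
  ultimately show ?thesis by (simp only: permute_factors_comp)
qed

text \<open>Acting on the entries amounts to permuting the rows by the inverse of \<sigma>, which
  has the same sign as \<sigma>. This makes both \<alpha> and the Cramer numerators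
  alternating.\<close>

lemma permute_factors_det:
  assumes s: "\<sigma> permutes {1..n}"
    and a: "a \<in> {1..n} \<rightarrow> {1..n} \<rightarrow> carrier (tensor_power R M n)"
    and eq: "\<And>p i. p \<in> {1..n} \<Longrightarrow> i \<in> {1..n} \<Longrightarrow> permute_factors \<sigma> (a p i) = a (inv_into UNIV \<sigma> p) i"
  shows "permute_factors \<sigma> (perm_det (tensor_power R M n) {1..n} a) =
    [sign \<sigma>] \<cdot>\<^bsub>tensor_power R M n\<^esub> perm_det (tensor_power R M n) {1..n} a"
proof -
  interpret T: cring "tensor_power R M n" by (rule tensor_power_cring)
  interpret h: ring_hom_cring "tensor_power R M n" "tensor_power R M n" "permute_factors \<sigma>"
    using permute_factors_hom[OF s] by unfold_locales
  have i: "inv_into UNIV \<sigma> permutes {1..n}" using permutes_inv[OF s] .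
  have "permute_factors \<sigma> (perm_det (tensor_power R M n) {1..n} a) =
      perm_det (tensor_power R M n) {1..n} (\<lambda>p i. permute_factors \<sigma> (a p i))"
    by (rule h.hom_perm_det[OF a])
  also have "\<dots> = perm_det (tensor_power R M n) {1..n} (\<lambda>p. a (inv_into UNIV \<sigma> p))"
    using a permutes_in_image[OF i] by (intro T.perm_det_cong eq) (auto simp: Pi_iff)
  also have "\<dots> = [sign (inv_into UNIV \<sigma>)] \<cdot>\<^bsub>tensor_power R M n\<^esub> perm_det (tensor_power R M n) {1..n} a"
    by (rule T.perm_det_permute_rows[OF _ a i]) simp
  also have "sign (inv_into UNIV \<sigma>) = sign \<sigma>"
    using s by (intro sign_inverse) (auto simp: permutation_permutes)
  finally show ?thesis .
qed

section \<open>Sums and products of invariants\<close>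

lemma tensor_invariants_cring:
  assumes "S \<subseteq> {1..n}"
  shows "cring (tensor_invariants R M n S)"
proof -
  interpret T: cring "tensor_power R M n" by (rule tensor_power_cring)
  note sub = tensor_invariants_subcring[OF assms]
  have "(tensor_power R M n)\<lparr>carrier := carrier (tensor_invariants R M n S)\<rparr> = tensor_invariants R M n S"
    by (simp add: tensor_invariants_def)
  then show ?thesis using T.subcring_iff[OF subcringE(1)[OF sub]] sub by simp
qed

text \<open>The inclusion of the invariants is a ring homomorphism, so it commutes with finite
  sums.\<close>

lemma finsum_tensor_invariants:
  assumes "S \<subseteq> {1..n}" "f \<in> I \<rightarrow> carrier (tensor_invariants R M n S)"
  shows "finsum (tensor_invariants R M n S) f I = finsum (tensor_power R M n) f I"
proof -
  interpret T: cring "tensor_power R M n" by (rule tensor_power_cring)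
  interpret C: cring "tensor_invariants R M n S" by (rule tensor_invariants_cring[OF assms(1)])
  interpret h: ring_hom_cring "tensor_invariants R M n S" "tensor_power R M n" id
    by unfold_locales (auto intro!: ring_hom_memI simp: tensor_invariants_def)
  show ?thesis using h.hom_finsum[OF assms(2)] by simp
qed

text \<open>The two signs cancel. This is the reason for inverting the square of \<alpha>:
  multiplying a Cramer numerator by one more \<alpha> makes it symmetric.\<close>

lemma alternating_product_mem_TS:
  assumes u: "u \<in> carrier (tensor_power R M n)" and v: "v \<in> carrier (tensor_power R M n)"
    and pu: "\<And>\<sigma>. \<sigma> permutes {1..n} \<Longrightarrow> permute_factors \<sigma> u = [sign \<sigma>] \<cdot>\<^bsub>tensor_power R M n\<^esub> u"
    and pv: "\<And>\<sigma>. \<sigma> permutes {1..n} \<Longrightarrow> permute_factors \<sigma> v = [sign \<sigma>] \<cdot>\<^bsub>tensor_power R M n\<^esub> v"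
  shows "u \<otimes>\<^bsub>tensor_power R M n\<^esub> v \<in> carrier (TS R M n)"
proof -
  interpret T: cring "tensor_power R M n" by (rule tensor_power_cring)
  have "permute_factors \<sigma> (u \<otimes>\<^bsub>tensor_power R M n\<^esub> v) = u \<otimes>\<^bsub>tensor_power R M n\<^esub> v"
    if s: "\<sigma> permutes {1..n}" for \<sigma>
    unfolding ring_hom_mult[OF permute_factors_hom[OF s] u v] pu[OF s] pv[OF s] using u v
    by (cases \<sigma> rule: sign_cases) (auto simp: T.add.int_pow_neg T.l_minus T.r_minus)
  then show ?thesis using u v by (simp add: TS_def tensor_invariants_def)
qed

lemma TS_subset_TS_last: "carrier (TS R M n) \<subseteq> carrier (TS_last R M n)"
proof -
  have "\<sigma> permutes {1..n}" if "\<sigma> permutes {1..n - 1}" for \<sigma>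
    by (rule permutes_subset[OF that]) auto
  then show ?thesis unfolding TS_def TS_last_def tensor_invariants_def by auto
qed

section \<open>Independence and spanning before localization\<close>

lemma TS_combination_zero:
  assumes n: "n \<ge> 1" and x: "x \<in> {1..n} \<rightarrow> carrier M" and a: "a \<in> {1..n} \<rightarrow> carrier (TS R M n)"
    and zero: "(\<Oplus>\<^bsub>tensor_power R M n\<^esub>i\<in>{1..n}. a i \<otimes>\<^bsub>tensor_power R M n\<^esub> coprojection R M n n (x i)) =
      \<zero>\<^bsub>tensor_power R M n\<^esub>"
    and i: "i \<in> {1..n}"
  shows "alternating_square R M n x \<otimes>\<^bsub>tensor_power R M n\<^esub> a i = \<zero>\<^bsub>tensor_power R M n\<^esub>"
proof -
  let ?T = "tensor_power R M n"
  interpret T: cring ?T by (rule tensor_power_cring)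
  let ?m = "\<lambda>p i. coprojection R M n p (x i)"
  have m: "?m \<in> {1..n} \<rightarrow> {1..n} \<rightarrow> carrier ?T" using x by (auto intro: coprojection_closed)
  have aT: "a \<in> {1..n} \<rightarrow> carrier ?T" using a by (auto simp: TS_def tensor_invariants_def)
  have "(\<Oplus>\<^bsub>?T\<^esub>i\<in>{1..n}. a i \<otimes>\<^bsub>?T\<^esub> ?m p i) = \<zero>\<^bsub>?T\<^esub>" if p: "p \<in> {1..n}" for p
  proof -
    \<comment> \<open>This transposition fixes the symmetric coefficients and carries the last
      coprojection to the one at \<open>p\<close>, so the given relation is transported to row
      \<open>p\<close>.\<close>
    let ?h = "permute_factors (transpose p n)"
    have t: "transpose p n permutes {1..n}" using p n by (intro permutes_swap_id) auto
    interpret h: ring_hom_cring ?T ?T ?h using permute_factors_hom[OF t] by unfold_locales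
    have "inv_into UNIV (transpose p n) n = p"
      by (simp add: inv_transpose_eq)
    then have hm: "?h (?m n i) = ?m p i" for i by (simp add: permute_factors_coprojection[OF t])
    have ha: "?h (a i) = a i" if "i \<in> {1..n}" for i
      using a that t by (auto simp: TS_def tensor_invariants_def Pi_iff)
    have am: "(\<lambda>i. a i \<otimes>\<^bsub>?T\<^esub> ?m q i) \<in> {1..n} \<rightarrow> carrier ?T" if "q \<in> {1..n}" for q
      using aT m that by (auto simp: Pi_iff)
    have "(\<Oplus>\<^bsub>?T\<^esub>i\<in>{1..n}. a i \<otimes>\<^bsub>?T\<^esub> ?m p i) = (\<Oplus>\<^bsub>?T\<^esub>i\<in>{1..n}. ?h (a i \<otimes>\<^bsub>?T\<^esub> ?m n i))"
      using aT m n p by (intro T.finsum_cong') (auto simp: ha hm Pi_iff)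
    also have "\<dots> = ?h \<zero>\<^bsub>?T\<^esub>"
      unfolding zero[symmetric] using h.hom_finsum[OF am[of n]] n by (simp add: comp_def)
    finally show ?thesis by simp
  qed
  \<comment> \<open>The transported relations form a homogeneous linear system for the
    \<open>a i\<close> with determinant \<alpha>. Already \<alpha> kills the coefficients, hence so
    does its square.\<close>
  from T.perm_det_kernel[OF _ m aT this i]
  have "alternating_tensor R M n x \<otimes>\<^bsub>?T\<^esub> a i = \<zero>\<^bsub>?T\<^esub>"
    unfolding alternating_tensor_eq_det[OF x] by simp
  moreover have "alternating_tensor R M n x \<in> carrier ?T" "a i \<in> carrier ?T"
    using T.perm_det_closed[OF m] aT i alternating_tensor_eq_det[OF x] by auto
  ultimately show ?thesis by (simp add: alternating_square_def T.m_assoc)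
qed

lemma alternating_square_mult_in_span:
  assumes n: "n \<ge> 1" and x: "x \<in> {1..n} \<rightarrow> carrier M" and y: "y \<in> carrier (TS_last R M n)"
  shows "\<exists>a \<in> {1..n} \<rightarrow> carrier (TS R M n). alternating_square R M n x \<otimes>\<^bsub>tensor_power R M n\<^esub> y =
    (\<Oplus>\<^bsub>tensor_power R M n\<^esub>i\<in>{1..n}. a i \<otimes>\<^bsub>tensor_power R M n\<^esub> coprojection R M n n (x i))"
proof -
  let ?T = "tensor_power R M n"
  interpret T: cring ?T by (rule tensor_power_cring)
  let ?m = "\<lambda>p i. coprojection R M n p (x i)"
  let ?y = "\<lambda>p. permute_factors (transpose p n) y"
  \<comment> \<open>The Cramer numerators: column \<open>i\<close> is replaced by the conjugates of
    \<open>y\<close>.\<close>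
  let ?D = "\<lambda>i. perm_det ?T {1..n} (\<lambda>p. (?m p)(i := ?y p))"
  let ?\<alpha> = "alternating_tensor R M n x"
  have m: "?m \<in> {1..n} \<rightarrow> {1..n} \<rightarrow> carrier ?T" using x by (auto intro: coprojection_closed)
  have yT: "y \<in> carrier ?T" using y by (simp add: TS_last_def tensor_invariants_def)
  have ys: "?y \<in> {1..n} \<rightarrow> carrier ?T"
  proof
    fix p assume "p \<in> {1..n}"
    then have "transpose p n permutes {1..n}" using n by (intro permutes_swap_id) auto
    then show "?y p \<in> carrier ?T" using ring_hom_closed[OF permute_factors_hom] yT by blast
  qed
  \<comment> \<open>\<open>transpose n n\<close> is the identity, so row \<open>n\<close> of the
    linear system has right-hand side \<open>y\<close> itself.\<close>
  have yn: "?y n = y" by (simp add: permute_factors_def permute_frag_id)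
  have my: "(\<lambda>p. (?m p)(i := ?y p)) \<in> {1..n} \<rightarrow> {1..n} \<rightarrow> carrier ?T" for i
    using m ys by (auto simp: Pi_iff)
  have \<alpha>: "?\<alpha> \<in> carrier ?T" using T.perm_det_closed[OF m] alternating_tensor_eq_det[OF x] by simp
  have D: "?D i \<in> carrier ?T" for i using T.perm_det_closed[OF my] .
  have "?\<alpha> \<otimes>\<^bsub>?T\<^esub> ?D i \<in> carrier (TS R M n)" for i
  proof (rule alternating_product_mem_TS[OF \<alpha> D])
    fix \<sigma> assume s: "\<sigma> permutes {1..n}"
    show "permute_factors \<sigma> ?\<alpha> = [sign \<sigma>] \<cdot>\<^bsub>?T\<^esub> ?\<alpha>"
      unfolding alternating_tensor_eq_det[OF x]
      by (rule permute_factors_det[OF s m]) (rule permute_factors_coprojection[OF s])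
    \<comment> \<open>Coprojections outside column \<open>i\<close> and conjugates inside it both
      have their row index moved by the inverse of \<sigma>.\<close>
    show "permute_factors \<sigma> (?D i) = [sign \<sigma>] \<cdot>\<^bsub>?T\<^esub> ?D i"
      by (rule permute_factors_det[OF s my])
        (simp add: permute_factors_coprojection[OF s] permute_factors_conjugate[OF n y s])
  qed
  moreover have "alternating_square R M n x \<otimes>\<^bsub>?T\<^esub> y = (\<Oplus>\<^bsub>?T\<^esub>i\<in>{1..n}. ?\<alpha> \<otimes>\<^bsub>?T\<^esub> ?D i \<otimes>\<^bsub>?T\<^esub> ?m n i)"
  proof -
    \<comment> \<open>Cramer's rule, read in row \<open>n\<close>; multiplying by \<alpha> once more
      makes the coefficients symmetric.\<close>
    have "(\<Oplus>\<^bsub>?T\<^esub>i\<in>{1..n}. ?D i \<otimes>\<^bsub>?T\<^esub> ?m n i) = ?\<alpha> \<otimes>\<^bsub>?T\<^esub> y"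
      using T.perm_det_cramer[OF _ m ys, of n] n
      unfolding alternating_tensor_eq_det[OF x] yn by simp
    then have "alternating_square R M n x \<otimes>\<^bsub>?T\<^esub> y = ?\<alpha> \<otimes>\<^bsub>?T\<^esub> (\<Oplus>\<^bsub>?T\<^esub>i\<in>{1..n}. ?D i \<otimes>\<^bsub>?T\<^esub> ?m n i)"
      using \<alpha> yT by (simp add: alternating_square_def T.m_assoc)
    also have "\<dots> = (\<Oplus>\<^bsub>?T\<^esub>i\<in>{1..n}. ?\<alpha> \<otimes>\<^bsub>?T\<^esub> (?D i \<otimes>\<^bsub>?T\<^esub> ?m n i))"
      using \<alpha> D m n by (intro T.finsum_rdistr) (auto simp: Pi_iff)
    also have "\<dots> = (\<Oplus>\<^bsub>?T\<^esub>i\<in>{1..n}. ?\<alpha> \<otimes>\<^bsub>?T\<^esub> ?D i \<otimes>\<^bsub>?T\<^esub> ?m n i)"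
      using \<alpha> D m n by (intro T.finsum_cong') (auto simp: Pi_iff T.m_assoc)
    finally show ?thesis .
  qed
  ultimately show ?thesis by (intro bexI[of _ "\<lambda>i. ?\<alpha> \<otimes>\<^bsub>?T\<^esub> ?D i"]) auto
qed

text \<open>The hypotheses of \<open>module_basis_localization\<close> hold for the two rings of
  invariants: the annihilation and spanning statements are proved in the full tensor power and
  transferred.\<close>

theorem module_basis_TS_last:
  assumes n: "n \<ge> 1" and x: "x \<in> {1..n} \<rightarrow> carrier M"
  defines "s \<equiv> alternating_square R M n x"
  shows "module_basis (localization (TS R M n) s)
    (module_via_hom (localization_map (TS_last R M n) s) (localization (TS_last R M n) s)) {1..n}
    (\<lambda>i. fraction (TS_last R M n) s (coprojection R M n n (x i)) 0)"
proof -
  let ?T = "tensor_power R M n" and ?C = "TS_last R M n" and ?B = "carrier (TS R M n)"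
  have eq: "?C\<lparr>carrier := ?B\<rparr> = TS R M n"
    by (simp add: TS_def TS_last_def tensor_invariants_def)
  have ops: "monoid.mult ?C = monoid.mult ?T" "\<zero>\<^bsub>?C\<^esub> = \<zero>\<^bsub>?T\<^esub>"
    by (simp_all add: TS_last_def tensor_invariants_def)
  interpret C: cring ?C unfolding TS_last_def by (rule tensor_invariants_cring) auto
  have BC: "subcring ?B ?C"
    using C.subcring_iff[OF TS_subset_TS_last] tensor_invariants_cring[of "{1..n}" n] eq
    by (simp add: TS_def)
  have b: "(\<lambda>i. coprojection R M n n (x i)) \<in> {1..n} \<rightarrow> carrier ?C"
    using x coprojection_mem[OF n] by auto
  \<comment> \<open>The determinant arguments take place in the full tensor power, since the
    coprojections on the other factors and the conjugates need not lie in \<open>?C\<close>.\<close>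
  have sum: "(\<Oplus>\<^bsub>?C\<^esub>i\<in>{1..n}. a i \<otimes>\<^bsub>?C\<^esub> coprojection R M n n (x i)) =
      (\<Oplus>\<^bsub>?T\<^esub>i\<in>{1..n}. a i \<otimes>\<^bsub>?T\<^esub> coprojection R M n n (x i))" if "a \<in> {1..n} \<rightarrow> ?B" for a
  proof -
    have "(\<lambda>i. a i \<otimes>\<^bsub>?C\<^esub> coprojection R M n n (x i)) \<in> {1..n} \<rightarrow> carrier ?C"
      using that b TS_subset_TS_last by (auto simp: Pi_iff subset_iff)
    then show ?thesis unfolding ops unfolding TS_last_def
      by (intro finsum_tensor_invariants) auto
  qed
  have "module_basis (localization (?C\<lparr>carrier := ?B\<rparr>) s)
    (module_via_hom (localization_map ?C s) (localization ?C s)) {1..n}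
    (\<lambda>i. fraction ?C s (coprojection R M n n (x i)) 0)"
  proof (rule module_basis_localization[OF C.is_cring BC _ _ b])
    show "s \<in> ?B" unfolding s_def by (rule alternating_square_mem[OF x])
    fix a i assume a: "a \<in> {1..n} \<rightarrow> ?B" and i: "i \<in> {1..n}"
      and z: "(\<Oplus>\<^bsub>?C\<^esub>i\<in>{1..n}. a i \<otimes>\<^bsub>?C\<^esub> coprojection R M n n (x i)) = \<zero>\<^bsub>?C\<^esub>"
    show "s \<otimes>\<^bsub>?C\<^esub> a i = \<zero>\<^bsub>?C\<^esub>"
      unfolding ops s_def
      by (rule TS_combination_zero[OF n x a z[unfolded sum[OF a], unfolded ops] i])
  next
    fix y assume "y \<in> carrier ?C"
    from alternating_square_mult_in_span[OF n x this] obtain a where a: "a \<in> {1..n} \<rightarrow> ?B"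
      and y: "s \<otimes>\<^bsub>?T\<^esub> y = (\<Oplus>\<^bsub>?T\<^esub>i\<in>{1..n}. a i \<otimes>\<^bsub>?T\<^esub> coprojection R M n n (x i))"
      unfolding s_def by (rule bexE)
    have "s \<otimes>\<^bsub>?C\<^esub> y = (\<Oplus>\<^bsub>?C\<^esub>i\<in>{1..n}. a i \<otimes>\<^bsub>?C\<^esub> coprojection R M n n (x i))"
      unfolding sum[OF a] unfolding ops by (rule y)
    then show "\<exists>a\<in>{1..n} \<rightarrow> ?B. s \<otimes>\<^bsub>?C\<^esub> y = (\<Oplus>\<^bsub>?C\<^esub>i\<in>{1..n}. a i \<otimes>\<^bsub>?C\<^esub> coprojection R M n n (x i))"
      by (rule bexI[OF _ a])
  qed simp
  then show ?thesis unfolding eq .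
qed

end

theorem theorem2p4:
  fixes A :: "('a, 'c) ring_scheme"
    and R :: "('a, 'r, 'm) module_scheme"
    and n :: nat
    and x :: "nat \<Rightarrow> 'r"
  assumes "algebra A R"
    and "n \<ge> 1"
    and "x \<in> {1..n} \<rightarrow> carrier R"
  defines "s \<equiv> alternating_square A R n x"
  defines "\<A> \<equiv> localization (TS A R n) s"
    and "\<R> \<equiv> localization (TS_last A R n) s"
  defines "\<phi>\<^sub>n \<equiv> \<lambda>r. fraction (TS_last A R n) s (coprojection A R n n r) 0"
  shows "module_basis \<A> (module_via_hom (localization_map (TS_last A R n) s) \<R>) {1..n}
    (\<lambda>i. \<phi>\<^sub>n (x i))"
  using algebra.module_basis_TS_last[OF assms(1-3)]
  unfolding s_def \<A>_def \<R>_def \<phi>\<^sub>n_def .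

end
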